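(* Let $k$ be a fixed positive integer. There is an algorithm which, given as input a $k$-degenerate graph $G$, computes the neighborhood polynomial $N(G,x)$ (i.e. all of its coefficients) in time polynomial in the size of $G$.
   Context: All graphs are simple, finite and undirected. For a graph $G=(V,E)$ and $v\in V$, $N_G(v)=\{u\in V: \{u,v\}\in E\}$ is the open neighborhood of $v$. The neighborhood complex of $G$ is $\mathcal N(G)=\{A\subseteq V : \exists v\in V,\ A\subseteq N_G(v)\}$, and the neighborhood polynomial of $G$ is $N(G,x)=\sum_{A\in\mathcal N(G)}x^{|A|}$. A graph $G$ of order $n$ is $k$-degenerate ($0<k<n$) if every non-empty subgraph of $G$, including $G$ itself, has at least one vertex of degree at most $k$ (in that subgraph). The integer $k$ is a constant: the polynomial bounding the running time may depend on $k$. *)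

theory Defs
  imports "HOL-Computational_Algebra.Polynomial" "HOL-Library.Log_Nat"
begin

section \<open>Graphs\<close>

text \<open>A simple undirected graph is given by its vertex set \<open>V\<close> and its set \<open>E\<close> of edges,
  where an edge is a two-element set of vertices.\<close>

definition simple_graph :: "'a set \<Rightarrow> 'a set set \<Rightarrow> bool" where
  "simple_graph V E \<longleftrightarrow> finite V \<and> (\<forall>e\<in>E. e \<subseteq> V \<and> card e = 2)"

definition neighborhood :: "'a set \<Rightarrow> 'a set set \<Rightarrow> 'a \<Rightarrow> 'a set" where
  "neighborhood V E v = {u \<in> V. {u, v} \<in> E}"

definition neighborhood_complex :: "'a set \<Rightarrow> 'a set set \<Rightarrow> 'a set set" where
  "neighborhood_complex V E = {A. A \<subseteq> V \<and> (\<exists>v\<in>V. A \<subseteq> neighborhood V E v)}"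

definition neighborhood_poly :: "'a set \<Rightarrow> 'a set set \<Rightarrow> nat poly" where
  "neighborhood_poly V E = (\<Sum>A\<in>neighborhood_complex V E. monom 1 (card A))"

definition subgraph :: "'a set \<Rightarrow> 'a set set \<Rightarrow> 'a set \<Rightarrow> 'a set set \<Rightarrow> bool" where
  "subgraph W F V E \<longleftrightarrow> simple_graph W F \<and> W \<subseteq> V \<and> F \<subseteq> E"

definition degree_in :: "'a set \<Rightarrow> 'a set set \<Rightarrow> 'a \<Rightarrow> nat" where
  "degree_in W F v = card (neighborhood W F v)"

definition degenerate :: "nat \<Rightarrow> 'a set \<Rightarrow> 'a set set \<Rightarrow> bool" where
  "degenerate k V E \<longleftrightarrow> 0 < k \<and> k < card V \<and>
     (\<forall>W F. subgraph W F V E \<and> W \<noteq> {} \<longrightarrow> (\<exists>v\<in>W. degree_in W F v \<le> k))"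


section \<open>Random access machines with logarithmic cost\<close>

text \<open>
  The model of computation is a random access machine, programmed by structured commands.
  A state consists of registers, addressed directly by the program, and of a memory, which is
  addressed only indirectly, through registers. Both hold natural numbers of unbounded size, and
  every step is charged the number of binary digits of all numbers it handles, addresses included.
  There is no multiplication, and subtraction is truncated at 0. With this logarithmic cost
  measure, polynomial time is the same as polynomial time on Turing machines.
\<close>

datatype com =
    Skip
  | Const nat nat         \<comment> \<open>\<open>x := c\<close>\<close>
  | Add nat nat nat       \<comment> \<open>\<open>x := y + z\<close>\<close>
  | Sub nat nat nat       \<comment> \<open>\<open>x := y - z\<close>\<close>
  | Load nat nat          \<comment> \<open>\<open>x := mem[y]\<close>\<close>
  | Store nat nat         \<comment> \<open>\<open>mem[x] := y\<close>\<close>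
  | Seq com com
  | If nat com com        \<comment> \<open>first branch if register \<open>x\<close> is nonzero\<close>
  | While nat com         \<comment> \<open>repeat as long as register \<open>x\<close> is nonzero\<close>

type_synonym state = "(nat \<Rightarrow> nat) \<times> (nat \<Rightarrow> nat)"

abbreviation bits :: "nat \<Rightarrow> nat" where
  "bits n \<equiv> floorlog 2 n"

text \<open>\<open>exec c s t s'\<close>: started in state \<open>s\<close>, the command \<open>c\<close> halts in state \<open>s'\<close> and the total
  cost of the run is \<open>t\<close>.\<close>

inductive exec :: "com \<Rightarrow> state \<Rightarrow> nat \<Rightarrow> state \<Rightarrow> bool" where
  exec_Skip: "exec Skip s 1 s"
| exec_Const: "exec (Const x c) (r, m) (1 + bits c) (r(x := c), m)"
| exec_Add: "exec (Add x y z) (r, m) (1 + bits (r y) + bits (r z)) (r(x := r y + r z), m)"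
| exec_Sub: "exec (Sub x y z) (r, m) (1 + bits (r y) + bits (r z)) (r(x := r y - r z), m)"
| exec_Load: "exec (Load x y) (r, m) (1 + bits (r y) + bits (m (r y))) (r(x := m (r y)), m)"
| exec_Store: "exec (Store x y) (r, m) (1 + bits (r x) + bits (r y)) (r, m(r x := r y))"
| exec_Seq: "exec c1 s t1 s1 \<Longrightarrow> exec c2 s1 t2 s2 \<Longrightarrow> exec (Seq c1 c2) s (t1 + t2) s2"
| exec_IfTrue: "r x \<noteq> 0 \<Longrightarrow> exec c1 (r, m) t s \<Longrightarrow> exec (If x c1 c2) (r, m) (1 + bits (r x) + t) s"
| exec_IfFalse: "r x = 0 \<Longrightarrow> exec c2 (r, m) t s \<Longrightarrow> exec (If x c1 c2) (r, m) (1 + bits (r x) + t) s"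
| exec_WhileFalse: "r x = 0 \<Longrightarrow> exec (While x c) (r, m) (1 + bits (r x)) (r, m)"
| exec_WhileTrue: "r x \<noteq> 0 \<Longrightarrow> exec c (r, m) t1 s1 \<Longrightarrow> exec (While x c) s1 t2 s2 \<Longrightarrow>
    exec (While x c) (r, m) (1 + bits (r x) + t1 + t2) s2"

inductive_cases exec_SkipE: "exec Skip s t s'"
inductive_cases exec_ConstE: "exec (Const x c) (r, m) t s'"
inductive_cases exec_AddE: "exec (Add x y z) (r, m) t s'"
inductive_cases exec_SubE: "exec (Sub x y z) (r, m) t s'"
inductive_cases exec_LoadE: "exec (Load x y) (r, m) t s'"
inductive_cases exec_StoreE: "exec (Store x y) (r, m) t s'"
inductive_cases exec_SeqE: "exec (Seq c1 c2) s t s'"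
inductive_cases exec_IfE: "exec (If x c1 c2) (r, m) t s'"
inductive_cases exec_WhileE: "exec (While x c) (r, m) t s'"

lemma exec_deterministic:
  "exec c s t s' \<Longrightarrow> exec c s u s'' \<Longrightarrow> u = t \<and> s'' = s'"
proof (induction arbitrary: u s'' rule: exec.induct)
  case (exec_Seq c1 s t1 s1 c2 t2 s2)
  from exec_Seq.prems obtain u1 v u2 where *: "u = u1 + u2" "exec c1 s u1 v" "exec c2 v u2 s''"
    by (rule exec_SeqE)
  from exec_Seq.IH(1)[OF *(2)] have "u1 = t1" "v = s1" by blast+
  with exec_Seq.IH(2) * show ?case by blast
next
  case (exec_IfTrue r x c1 m t s c2)
  from exec_IfTrue.prems obtain v where "u = 1 + bits (r x) + v" "exec c1 (r, m) v s''"
    by (rule exec_IfE) (use exec_IfTrue.hyps in force)+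
  with exec_IfTrue.IH show ?case by blast
next
  case (exec_IfFalse r x c2 m t s c1)
  from exec_IfFalse.prems obtain v where "u = 1 + bits (r x) + v" "exec c2 (r, m) v s''"
    by (rule exec_IfE) (use exec_IfFalse.hyps in force)+
  with exec_IfFalse.IH show ?case by blast
next
  case (exec_WhileFalse r x c m)
  from exec_WhileFalse.prems show ?case
    by (rule exec_WhileE) (use exec_WhileFalse.hyps in force)+
next
  case (exec_WhileTrue r x c m t1 s1 t2 s2)
  from exec_WhileTrue.prems obtain u1 v u2 where *: "u = 1 + bits (r x) + u1 + u2"
    "exec c (r, m) u1 v" "exec (While x c) v u2 s''"
    by (rule exec_WhileE) (use exec_WhileTrue.hyps in force)+
  from exec_WhileTrue.IH(1)[OF *(2)] have "u1 = t1" "v = s1" by blast+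
  with exec_WhileTrue.IH(2) * show ?case by blast
qed (auto elim!: exec_SkipE exec_ConstE exec_AddE exec_SubE exec_LoadE exec_StoreE)

text \<open>The input word is placed at the beginning of the memory and its length in register 0;
  everything else is 0. The output word is read off in the same way.\<close>

definition initial_state :: "nat list \<Rightarrow> state" where
  "initial_state w = ((\<lambda>_. 0)(0 := length w), (\<lambda>i. if i < length w then w ! i else 0))"

definition output_of :: "state \<Rightarrow> nat list" where
  "output_of s = map (snd s) [0..<fst s 0]"

definition computes_within :: "com \<Rightarrow> nat list \<Rightarrow> nat list \<Rightarrow> nat \<Rightarrow> bool" where
  "computes_within P w out b \<longleftrightarrow>
     (\<exists>t s. exec P (initial_state w) t s \<and> output_of s = out \<and> t \<le> b)"


section \<open>Graphs as inputs\<close>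

text \<open>The vertices are numbered in the order of the list \<open>vs\<close>; the code consists of the number of
  vertices, followed by the rows of the adjacency matrix.\<close>

definition graph_code :: "'a list \<Rightarrow> 'a set set \<Rightarrow> nat list" where
  "graph_code vs E = length vs # [if {u, v} \<in> E then 1 else 0. u \<leftarrow> vs, v \<leftarrow> vs]"

end

theory Submission
  imports Defs
begin

text \<open>
  Write \<open>C(S)\<close> for the set of common neighbors of \<open>S\<close>; a set \<open>A\<close> belongs to the neighborhood
  complex iff \<open>C(A) \<noteq> {}\<close>. A \<open>k\<close>-degenerate graph contains no complete bipartite graph with more
  than \<open>k\<close> vertices on both sides, so \<open>card A > k\<close> implies \<open>card (C(A)) \<le> k\<close>. Since
  \<open>S \<subseteq> C(A) \<longleftrightarrow> A \<subseteq> C(S)\<close>, the alternating sum over the nonempty subsets \<open>S\<close> of \<open>C(A)\<close> turns the number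
  of sets \<open>A\<close> of size \<open>j > k\<close> in the complex into
  \<open>\<Sum>S. (-1)^(card S + 1) * (card (C(S)) choose j)\<close>, where \<open>S\<close> ranges over the sets with
  \<open>1 \<le> card S \<le> k\<close>. There are O(\<open>n^k\<close>) such \<open>S\<close>, and \<open>k\<close> nested loops visit them all; the
  same loops count the members of the complex of size at most \<open>k\<close> directly. No elimination order
  is ever computed.

  For the running time it suffices to count steps: a step at most doubles the largest number in the
  machine, so after \<open>T\<close> steps every number has at most \<open>T\<close> digits more than in the beginning.
\<close>

section \<open>Cost-bounded weakest preconditions\<close>

abbreviation seq :: "com \<Rightarrow> com \<Rightarrow> com" (infixr ";;" 60) where
  "c ;; d \<equiv> Seq c d"

section \<open>Step counts, digit lengths and total cost\<close>

definition fits :: "nat \<Rightarrow> state \<Rightarrow> bool" where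
  "fits L s \<longleftrightarrow> (\<forall>x. bits (fst s x) \<le> L) \<and> (\<forall>a. bits (snd s a) \<le> L)"

lemma fits_mono: "fits L s \<Longrightarrow> L \<le> L' \<Longrightarrow> fits L' s"
  unfolding fits_def by (meson le_trans)

lemma bits_le_iff: "bits n \<le> L \<longleftrightarrow> n < 2 ^ L"
  by (cases "n = 0") (auto simp: floorlog_le_iff)

lemma bits_add_le: "bits x \<le> L \<Longrightarrow> bits y \<le> L \<Longrightarrow> bits (x + y) \<le> Suc L"
  by (simp add: bits_le_iff)

lemma bits_diff_le: "bits x \<le> L \<Longrightarrow> bits (x - y) \<le> L"
  by (simp add: bits_le_iff)

text \<open>\<open>T\<close> counts steps, not cost. A step handles at most two numbers and adds at
  most one digit, so \<open>T\<close> steps from numbers of at most \<open>L\<close> digits cost at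
  most \<open>T * (1 + 2 * (L + T))\<close>. Quantifying over \<open>L\<close> here lets step counts
  simply add up under composition.\<close>

definition runs_in :: "nat \<Rightarrow> com \<Rightarrow> state \<Rightarrow> (state \<Rightarrow> bool) \<Rightarrow> bool" where
  "runs_in T c s Q \<longleftrightarrow> (\<forall>L. fits L s \<longrightarrow>
     (\<exists>t s'. exec c s t s' \<and> fits (L + T) s' \<and> t \<le> T * (1 + 2 * (L + T)) \<and> Q s'))"

lemma runs_inI:
  assumes "\<And>L. fits L s \<Longrightarrow> exec c s t s' \<and> fits (L + T) s' \<and> t \<le> T * (1 + 2 * (L + T))" "Q s'"
  shows "runs_in T c s Q"
  unfolding runs_in_def using assms by blast

lemma runs_in_mono:
  assumes "runs_in T c s Q" "T \<le> T'" "\<And>s'. Q s' \<Longrightarrow> Q' s'"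
  shows "runs_in T' c s Q'"
  unfolding runs_in_def
proof (intro allI impI)
  fix L assume "fits L s"
  then obtain t s' where *: "exec c s t s'" "fits (L + T) s'" "t \<le> T * (1 + 2 * (L + T))" "Q s'"
    using assms(1) unfolding runs_in_def by blast
  have "T * (1 + 2 * (L + T)) \<le> T' * (1 + 2 * (L + T'))"
    using assms(2) by (intro mult_mono) auto
  with * show "\<exists>t s'. exec c s t s' \<and> fits (L + T') s' \<and> t \<le> T' * (1 + 2 * (L + T')) \<and> Q' s'"
    using assms fits_mono[OF *(2), of "L + T'"] by (meson add_left_mono le_trans)
qed

text \<open>The second run starts with numbers of up to \<open>L + T\<close> digits; the common
  bound \<open>L + T + U\<close> covers the lengths in both runs.\<close>

lemma cost_add_le:
  fixes L T U :: nat
  assumes "t \<le> T * (1 + 2 * (L + T))" "u \<le> U * (1 + 2 * (L + T + U))"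
  shows "t + u \<le> (T + U) * (1 + 2 * (L + (T + U)))"
proof -
  from assms(1) have "t \<le> T * (1 + 2 * (L + (T + U)))"
    by (rule le_trans) (intro mult_left_mono; simp)
  with assms(2) have "t + u \<le> T * (1 + 2 * (L + (T + U))) + U * (1 + 2 * (L + (T + U)))"
    by (intro add_mono) (simp_all only: add.assoc)
  then show ?thesis by (simp only: add_mult_distrib)
qed

lemma runs_in_Seq:
  assumes "runs_in T c s (\<lambda>s'. runs_in U d s' Q)"
  shows "runs_in (T + U) (c ;; d) s Q"
  unfolding runs_in_def
proof (intro allI impI)
  fix L assume "fits L s"
  then obtain t s' where 1: "exec c s t s'" "fits (L + T) s'" "t \<le> T * (1 + 2 * (L + T))"
    "runs_in U d s' Q"
    using assms unfolding runs_in_def[of T] by blast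
  then obtain u s'' where 2: "exec d s' u s''" "fits (L + T + U) s''"
      "u \<le> U * (1 + 2 * (L + T + U))" "Q s''"
    unfolding runs_in_def by blast
  show "\<exists>t s'. exec (c ;; d) s t s' \<and> fits (L + (T + U)) s' \<and>
      t \<le> (T + U) * (1 + 2 * (L + (T + U))) \<and> Q s'"
    using exec_Seq[OF 1(1) 2(1)] 2(2,4) cost_add_le[OF 1(3) 2(3)] unfolding add.assoc by blast
qed

text \<open>Serves the tests of \<open>If\<close> and \<open>While\<close>, which count as one step
  reading one register.\<close>

lemma test_cost_le:
  assumes "fits L (r, m)" "t \<le> T * (1 + 2 * (L + T))"
  shows "1 + bits (r x) + t \<le> Suc T * (1 + 2 * (L + Suc T))"
proof -
  have "1 + bits (r x) \<le> 1 * (1 + 2 * (L + 1))"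
    using assms(1) by (auto simp: fits_def intro: le_trans[of _ L])
  moreover have "t \<le> T * (1 + 2 * (L + 1 + T))"
    by (rule le_trans[OF assms(2)], intro mult_left_mono) auto
  ultimately show ?thesis using cost_add_le[of _ 1 L t T] by simp
qed

lemma runs_in_If:
  assumes "r x \<noteq> 0 \<Longrightarrow> runs_in T c (r, m) Q" "r x = 0 \<Longrightarrow> runs_in T d (r, m) Q"
  shows "runs_in (Suc T) (If x c d) (r, m) Q"
  unfolding runs_in_def
proof (intro allI impI)
  fix L assume L: "fits L (r, m)"
  let ?e = "if r x = 0 then d else c"
  have "runs_in T ?e (r, m) Q" using assms by simp
  with L obtain t s' where *: "exec ?e (r, m) t s'" "fits (L + T) s'"
      "t \<le> T * (1 + 2 * (L + T))" "Q s'"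
    unfolding runs_in_def by blast
  have "exec (If x c d) (r, m) (1 + bits (r x) + t) s'"
    using *(1) exec_IfTrue[of r x c m t s' d] exec_IfFalse[of r x d m t s' c]
    by (cases "r x = 0") simp_all
  moreover have "fits (L + Suc T) s'" by (rule fits_mono[OF *(2)]) simp
  moreover note *(4) test_cost_le[OF L *(3), of x]
  ultimately show "\<exists>t s'. exec (If x c d) (r, m) t s' \<and> fits (L + Suc T) s' \<and>
      t \<le> Suc T * (1 + 2 * (L + Suc T)) \<and> Q s'" by blast
qed

lemma runs_in_WhileFalse:
  assumes "r x = 0" "Q (r, m)"
  shows "runs_in 1 (While x c) (r, m) Q"
proof (rule runs_inI)
  fix L assume "fits L (r, m)"
  then show "exec (While x c) (r, m) (1 + bits (r x)) (r, m) \<and> fits (L + 1) (r, m) \<and>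
      1 + bits (r x) \<le> 1 * (1 + 2 * (L + 1))"
    using assms exec_WhileFalse[of r x c m] fits_mono[of L "(r, m)" "L + 1"]
      test_cost_le[of L r m 0 0 x] by simp
qed fact

lemma runs_in_WhileTrue:
  assumes "r x \<noteq> 0" "runs_in T c (r, m) (\<lambda>s. runs_in U (While x c) s Q)"
  shows "runs_in (Suc (T + U)) (While x c) (r, m) Q"
  unfolding runs_in_def
proof (intro allI impI)
  fix L assume L: "fits L (r, m)"
  with assms(2) obtain t s' where 1: "exec c (r, m) t s'" "fits (L + T) s'"
    "t \<le> T * (1 + 2 * (L + T))" "runs_in U (While x c) s' Q"
    unfolding runs_in_def[of T] by blast
  then obtain u s'' where 2: "exec (While x c) s' u s''" "fits (L + T + U) s''"
      "u \<le> U * (1 + 2 * (L + T + U))" "Q s''"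
    unfolding runs_in_def by blast
  show "\<exists>t s'. exec (While x c) (r, m) t s' \<and> fits (L + Suc (T + U)) s' \<and>
      t \<le> Suc (T + U) * (1 + 2 * (L + Suc (T + U))) \<and> Q s'"
  proof (intro exI conjI)
    show "exec (While x c) (r, m) (1 + bits (r x) + t + u) s''"
      by (rule exec_WhileTrue[OF assms(1) 1(1) 2(1)])
    show "fits (L + Suc (T + U)) s''" by (rule fits_mono[OF 2(2)]) simp
    show "1 + bits (r x) + t + u \<le> Suc (T + U) * (1 + 2 * (L + Suc (T + U)))"
      using test_cost_le[OF L cost_add_le[OF 1(3) 2(3)], of x] by (simp only: add.assoc)
  qed fact
qed

text \<open>Charges every loop with \<open>N\<close> iterations.\<close>

fun cost :: "nat \<Rightarrow> com \<Rightarrow> nat" where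
  "cost N (Const x c) = 1 + bits c"
| "cost N (Seq c d) = cost N c + cost N d"
| "cost N (If x c d) = Suc (cost N c + cost N d)"
| "cost N (While x c) = Suc (N * Suc (cost N c))"
| "cost N _ = 1"

text \<open>Only a loop multiplies by \<open>N\<close>, so the degree is bounded by the nesting
  depth of loops, a constant for a fixed program.\<close>

lemma cost_poly: "\<exists>p :: nat poly. \<forall>N. cost N c = poly p N"
proof (induction c)
  case (Seq c d)
  then obtain p q :: "nat poly" where "\<forall>N. cost N c = poly p N" "\<forall>N. cost N d = poly q N" by blast
  then show ?case by (intro exI[of _ "p + q"]) simp
next
  case (If x c d)
  then obtain p q :: "nat poly" where "\<forall>N. cost N c = poly p N" "\<forall>N. cost N d = poly q N" by blast
  then show ?case by (intro exI[of _ "1 + p + q"]) simp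
next
  case (While x c)
  then obtain p :: "nat poly" where "\<forall>N. cost N c = poly p N" by blast
  then show ?case by (intro exI[of _ "1 + [:0, 1:] * (1 + p)"]) simp
next
  case (Const x c)
  show ?case by (intro exI[of _ "[:1 + bits c:]"]) simp
qed (intro exI[of _ 1]; simp)+

section \<open>Program rules with counting loops\<close>

definition wp :: "nat \<Rightarrow> com \<Rightarrow> state \<Rightarrow> (state \<Rightarrow> bool) \<Rightarrow> bool" where
  "wp N c = runs_in (cost N c) c"

lemma wp_Skip: "Q s \<Longrightarrow> wp N Skip s Q"
  unfolding wp_def
  by (rule runs_inI[OF conjI[OF exec_Skip]]) (auto intro: fits_mono)

lemma fits_upd:
  assumes "fits L (r, m)" "bits v \<le> L + T"
  shows "fits (L + T) (r(x := v), m)" "fits (L + T) (r, m(a := v))"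
  using assms unfolding fits_def by (auto intro: trans_le_add1)

text \<open>The constant may be longer than every number present, so the step count
  \<open>1 + bits c\<close> also pays for its digits.\<close>

lemma wp_Const: "Q (r(x := c), m) \<Longrightarrow> wp N (Const x c) (r, m) Q"
  unfolding wp_def
  by (rule runs_inI[OF conjI[OF exec_Const conjI[OF fits_upd(1)]]]) simp_all

lemma runs_in_step:
  assumes "exec c s (1 + bits x + bits y) s'"
    and "\<And>L. fits L s \<Longrightarrow> bits x \<le> L \<and> bits y \<le> L \<and> fits (L + 1) s'" "Q s'"
  shows "runs_in 1 c s Q"
proof (rule runs_inI)
  fix L assume "fits L s"
  then show "exec c s (1 + bits x + bits y) s' \<and> fits (L + 1) s' \<and>
      1 + bits x + bits y \<le> 1 * (1 + 2 * (L + 1))"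
    using assms(1) assms(2)[of L] by simp
qed fact

lemma fitsD: "fits L (r, m) \<Longrightarrow> bits (r x) \<le> L" "fits L (r, m) \<Longrightarrow> bits (m a) \<le> L"
  by (simp_all add: fits_def)

lemma wp_Add: "Q (r(x := r y + r z), m) \<Longrightarrow> wp N (Add x y z) (r, m) Q"
  unfolding wp_def cost.simps
  by (erule runs_in_step[OF exec_Add, rotated])
    (intro conjI fits_upd; simp add: fitsD bits_add_le)

lemma wp_Sub: "Q (r(x := r y - r z), m) \<Longrightarrow> wp N (Sub x y z) (r, m) Q"
  unfolding wp_def cost.simps
  by (erule runs_in_step[OF exec_Sub, rotated])
    (intro conjI fits_upd; simp add: fitsD bits_diff_le le_SucI)

lemma wp_Load: "Q (r(x := m (r y)), m) \<Longrightarrow> wp N (Load x y) (r, m) Q"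
  unfolding wp_def cost.simps
  by (erule runs_in_step[OF exec_Load, rotated])
    (intro conjI fits_upd; simp add: fitsD le_SucI)

lemma wp_Store: "Q (r, m(r x := r y)) \<Longrightarrow> wp N (Store x y) (r, m) Q"
  unfolding wp_def cost.simps
  by (erule runs_in_step[OF exec_Store, rotated])
    (intro conjI fits_upd; simp add: fitsD le_SucI)

lemma wp_Seq: "wp N c s (\<lambda>s'. wp N d s' Q) \<Longrightarrow> wp N (c ;; d) s Q"
  unfolding wp_def by (simp add: runs_in_Seq)

lemma wp_If:
  assumes "r x \<noteq> 0 \<Longrightarrow> wp N c (r, m) Q" "r x = 0 \<Longrightarrow> wp N d (r, m) Q"
  shows "wp N (If x c d) (r, m) Q"
  using assms unfolding wp_def cost.simps
  by (intro runs_in_If) (auto elim: runs_in_mono)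

text \<open>All loops of the program count a register down to 0, so the invariant is indexed by the
  value of that register. The body starts under the invariant for \<open>Suc i\<close> and does the
  decrement itself; \<open>n \<le> N\<close> justifies the charge of \<open>N\<close>
  iterations.\<close>

lemma wp_For:
  assumes init: "I n s" "n \<le> N"
    and reg: "\<And>i s. I i s \<Longrightarrow> fst s x = i"
    and step: "\<And>i r m. i < n \<Longrightarrow> I (Suc i) (r, m) \<Longrightarrow> r x = Suc i \<Longrightarrow> wp N c (r, m) (I i)"
    and final: "\<And>r m. I 0 (r, m) \<Longrightarrow> Q (r, m)"
  shows "wp N (While x c) s Q"
proof -
  have "runs_in (Suc (i * Suc (cost N c))) (While x c) s Q" if "I i s" "i \<le> n" for i s
    using that
  proof (induction i arbitrary: s)
    case 0
    then show ?case
      using runs_in_WhileFalse[of "fst s" x Q "snd s" c] reg[of 0 s] final[of "fst s" "snd s"] by simp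
  next
    case (Suc i)
    have x: "fst s x = Suc i" using reg Suc.prems by blast
    have "wp N c (fst s, snd s) (I i)"
      using step[of i "fst s" "snd s"] Suc.prems x by simp
    then have "runs_in (cost N c) c (fst s, snd s)
        (\<lambda>s. runs_in (Suc (i * Suc (cost N c))) (While x c) s Q)"
      unfolding wp_def using Suc by (auto elim!: runs_in_mono)
    from runs_in_WhileTrue[OF _ this] x show ?case by (simp add: algebra_simps)
  qed
  from this[OF init(1)] show ?thesis
    unfolding wp_def cost.simps
    by (rule runs_in_mono) (use init(2) in \<open>simp_all del: mult_Suc_right\<close>)
qed

lemmas wp_intros = wp_Skip wp_Const wp_Add wp_Sub wp_Load wp_Store wp_Seq wp_If

section \<open>Visiting all small vertex sets\<close>

text \<open>The registers from 12 on are grouped by the level of the nested loops: \<open>regI s\<close> holds the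
  vertex \<open>i\<close> chosen at level \<open>s\<close>, \<open>regP s\<close> the address \<open>1 + i * n\<close> of its row of the adjacency matrix,
  and \<open>regC s\<close> counts the sets of size \<open>s\<close> with a common neighbor. \<open>rZ\<close>, which is also the input
  length, and \<open>rNeg\<close> hold the addresses of two histograms behind the input: entry \<open>c\<close> counts the odd
  (even) sets with exactly \<open>c\<close> common neighbors.\<close>

abbreviation (input) rZ :: nat where "rZ \<equiv> 0"
abbreviation (input) rN :: nat where "rN \<equiv> 1"
abbreviation (input) rOne :: nat where "rOne \<equiv> 2"
abbreviation (input) rNeg :: nat where "rNeg \<equiv> 3"
abbreviation (input) rI :: nat where "rI \<equiv> 4"
abbreviation (input) rFlag :: nat where "rFlag \<equiv> 5"
abbreviation (input) rCnt :: nat where "rCnt \<equiv> 6"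
abbreviation (input) rAddr :: nat where "rAddr \<equiv> 7"
abbreviation (input) rVal :: nat where "rVal \<equiv> 8"
abbreviation (input) rPtr :: nat where "rPtr \<equiv> 9"
abbreviation (input) rTmp :: nat where "rTmp \<equiv> 10"
abbreviation (input) rZero :: nat where "rZero \<equiv> 11"

definition regI :: "nat \<Rightarrow> nat" where "regI s = 3 * s + 12"
definition regP :: "nat \<Rightarrow> nat" where "regP s = 3 * s + 13"
definition regC :: "nat \<Rightarrow> nat" where "regC s = 3 * s + 14"

lemma reg_distinct [simp]:
  "regI s = regI t \<longleftrightarrow> s = t" "regP s = regP t \<longleftrightarrow> s = t" "regC s = regC t \<longleftrightarrow> s = t"
  "regI s \<noteq> regP t" "regP s \<noteq> regI t" "regI s \<noteq> regC t" "regC s \<noteq> regI t"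
  "regP s \<noteq> regC t" "regC s \<noteq> regP t"
  "x \<le> 11 \<Longrightarrow> regI s \<noteq> x" "x \<le> 11 \<Longrightarrow> regP s \<noteq> x" "x \<le> 11 \<Longrightarrow> regC s \<noteq> x"
  "x \<le> 11 \<Longrightarrow> x \<noteq> regI s" "x \<le> 11 \<Longrightarrow> x \<noteq> regP s" "x \<le> 11 \<Longrightarrow> x \<noteq> regC s"
  "x \<le> 11 \<Longrightarrow> \<not> regI s \<le> x" "x \<le> 11 \<Longrightarrow> \<not> regP s \<le> x" "x \<le> 11 \<Longrightarrow> \<not> regC s \<le> x"
  unfolding regI_def regP_def regC_def by presburger+

text \<open>Programs name registers literally, so the loop over the chosen vertices is unrolled when
  the program is built. The levels never exceed the constant \<open>k\<close>.\<close>

primrec adj_test :: "nat \<Rightarrow> com" where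
  "adj_test 0 = Const rFlag 1"
| "adj_test (Suc l) = adj_test l ;; Add rAddr (regP (Suc l)) rI ;; Load rVal rAddr ;;
     If rVal Skip (Const rFlag 0)"

text \<open>Continuation form: \<open>Q\<close> has to hold for all register contents that agree
  with \<open>r\<close> outside the scratch registers and carry the result. The later program
  specifications follow the same pattern.\<close>

lemma wp_adj_test:
  assumes "\<And>r'. (\<And>x. x \<notin> {rFlag, rAddr, rVal} \<Longrightarrow> r' x = r x) \<Longrightarrow>
     r' rFlag = of_bool (\<forall>l\<in>{1..s}. m (r (regP l) + r rI) \<noteq> 0) \<Longrightarrow> Q (r', m)"
  shows "wp N (adj_test s) (r, m) Q"
  using assms
proof (induction s arbitrary: Q)
  case 0
  show ?case unfolding adj_test.simps
    by (intro wp_intros 0) auto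
next
  case (Suc s)
  have *: "(\<forall>l\<in>{1..Suc s}. P l) \<longleftrightarrow> (\<forall>l\<in>{1..s}. P l) \<and> P (Suc s)" for P
    by (auto simp: atLeastAtMostSuc_conv)
  show ?case unfolding adj_test.simps
    by (intro wp_intros Suc.IH Suc.prems) (auto simp: * simp del: One_nat_def)
qed

definition common_count :: "nat \<Rightarrow> com" where
  "common_count s = Const rCnt 0 ;; Add rI rN rZero ;;
     While rI (Sub rI rI rOne ;; adj_test s ;; Add rCnt rCnt rFlag)"

lemma wp_common_count:
  assumes "r rN = n" "r rOne = 1" "r rZero = 0" "n \<le> N"
    and post: "\<And>r'. (\<And>x. x \<notin> {4..8} \<Longrightarrow> r' x = r x) \<Longrightarrow>
     r' rCnt = card {u. u < n \<and> (\<forall>l\<in>{1..s}. m (r (regP l) + u) \<noteq> 0)} \<Longrightarrow> Q (r', m)"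
  shows "wp N (common_count s) (r, m) Q"
proof -
  let ?P = "\<lambda>u. \<forall>l\<in>{1..s}. m (r (regP l) + u) \<noteq> 0"
  define I where "I i st \<longleftrightarrow> snd st = m \<and> (\<forall>x. x \<notin> {4..8} \<longrightarrow> fst st x = r x) \<and> fst st rI = i \<and>
    fst st rCnt = card {u. i \<le> u \<and> u < n \<and> ?P u}" for i :: nat and st :: state
  \<comment> \<open>The loop counts down, so each round extends the interval of inspected vertices
    by a new least element \<open>i\<close>.\<close>
  have card: "card {u. i \<le> u \<and> u < n \<and> ?P u} = card {u. Suc i \<le> u \<and> u < n \<and> ?P u} + of_bool (?P i)"
    if "i < n" for i
  proof -
    have "{u. i \<le> u \<and> u < n \<and> ?P u} =
        (if ?P i then insert i {u. Suc i \<le> u \<and> u < n \<and> ?P u} else {u. Suc i \<le> u \<and> u < n \<and> ?P u})"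
      using that le_eq_less_or_eq by (auto simp: Suc_le_eq)
    then show ?thesis by simp
  qed
  show ?thesis unfolding common_count_def
  proof (intro wp_intros, rule wp_For[where I = I and n = n])
    show "wp N (Sub rI rI rOne ;; adj_test s ;; Add rCnt rCnt rFlag) (r', m') (I i)"
      if i: "i < n" and I: "I (Suc i) (r', m')" for i r' m'
    proof (intro wp_intros wp_adj_test)
      fix r'' assume *: "\<And>x. x \<notin> {rFlag, rAddr, rVal} \<Longrightarrow> r'' x = (r'(rI := r' rI - r' rOne)) x"
        "r'' rFlag = of_bool (\<forall>l\<in>{1..s}. m' ((r'(rI := r' rI - r' rOne)) (regP l) + (r'(rI := r' rI - r' rOne)) rI) \<noteq> 0)"
      have f: "m' = m" "r' rI = Suc i" "r' rOne = 1" "\<And>l. r' (regP l) = r (regP l)"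
        using I assms by (auto simp: I_def regP_def)
      have "r'' rFlag = of_bool (?P i)" using *(2) f by simp
      moreover have "r'' x = (if x = rI then i else r' x)" if "x \<notin> {rFlag, rAddr, rVal}" for x
        using *(1)[OF that] f by simp
      ultimately show "I i (r''(rCnt := r'' rCnt + r'' rFlag), m')"
        using I card[OF i] by (auto simp: I_def)
    qed
    show "I n ((r(rCnt := 0))(rI := (r(rCnt := 0)) rN + (r(rCnt := 0)) rZero), m)"
      using assms by (auto simp: I_def)
    show "Q (r', m')" if "I 0 (r', m')" for r' m'
      using that post[of r'] by (auto simp: I_def)
  qed (use assms in \<open>auto simp: I_def\<close>)
qed

definition record_set :: "nat \<Rightarrow> com" where
  "record_set s = common_count s ;; If rCnt (Add (regC s) (regC s) rOne) Skip ;;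
     Add rAddr (if odd s then rZ else rNeg) rCnt ;; Load rVal rAddr ;; Add rVal rVal rOne ;;
     Store rAddr rVal"

lemma wp_record_set:
  assumes "r rN = n" "r rOne = 1" "r rZero = 0" "n \<le> N"
    and cnt: "c = card {u. u < n \<and> (\<forall>l\<in>{1..s}. m (r (regP l) + u) \<noteq> 0)}"
    and addr: "a = (if odd s then r rZ else r rNeg) + c"
    and post: "\<And>r'. (\<And>x. x \<notin> {4..8} \<Longrightarrow> r' x = r x + of_bool (x = regC s \<and> c \<noteq> 0)) \<Longrightarrow>
       Q (r', m(a := Suc (m a)))"
  shows "wp N (record_set s) (r, m) Q"
  unfolding record_set_def
proof (rule wp_Seq, rule wp_common_count[OF assms(1-4)])
  fix r' assume r': "\<And>x. x \<notin> {4..8} \<Longrightarrow> r' x = r x"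
    "r' rCnt = card {u. u < n \<and> (\<forall>l\<in>{1..s}. m (r (regP l) + u) \<noteq> 0)}"
  then have c: "r' rCnt = c" using cnt by simp
  have f: "r' rZ = r rZ" "r' rNeg = r rNeg" "r' rOne = 1" using r' assms by auto
  let ?r = "\<lambda>v. (r'(regC s := v))(rAddr := a, rVal := Suc (m a))"
  have post': "Q (?r v, m(a := Suc (m a)))" if "v = r' (regC s) + of_bool (c \<noteq> 0)" for v
    using r' that by (intro post) auto
  show "wp N (If rCnt (Add (regC s) (regC s) rOne) Skip ;;
     Add rAddr (if odd s then rZ else rNeg) rCnt ;; Load rVal rAddr ;; Add rVal rVal rOne ;;
     Store rAddr rVal) (r', m) Q"
    using post'[of "r' (regC s)"] post'[of "Suc (r' (regC s))"] f c addr
    by (cases "odd s") (intro wp_intros; auto simp: fun_upd_twist fun_upd_idem)+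
qed

text \<open>Each level starts below the vertex chosen one level up, so the chosen vertices strictly
  decrease and every set is met exactly once. In the absence of multiplication, row addresses are
  maintained by subtracting \<open>n\<close> along with each decrement.\<close>

primrec enum_sets :: "nat \<Rightarrow> nat \<Rightarrow> com" where
  "enum_sets 0 s = Skip"
| "enum_sets (Suc d) s = Add (regI (Suc s)) (regI s) rZero ;; Add (regP (Suc s)) (regP s) rZero ;;
     While (regI (Suc s)) (Sub (regI (Suc s)) (regI (Suc s)) rOne ;;
       Sub (regP (Suc s)) (regP (Suc s)) rN ;; record_set (Suc s) ;; enum_sets d (Suc s))"

text \<open>The sum of \<open>f (card T) T\<close> over the sets \<open>T = S \<union> U\<close> with \<open>U \<subseteq> {..<b}\<close> and \<open>1 \<le> card U \<le> d\<close>, where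
  \<open>S\<close> has size \<open>s\<close> and lies above \<open>b\<close>; the recursion follows the loops of \<open>enum_sets\<close>.\<close>

fun ext_sum :: "(nat \<Rightarrow> nat set \<Rightarrow> nat) \<Rightarrow> nat \<Rightarrow> nat \<Rightarrow> nat \<Rightarrow> nat set \<Rightarrow> nat" where
  "ext_sum f 0 s b S = 0"
| "ext_sum f (Suc d) s 0 S = 0"
| "ext_sum f (Suc d) s (Suc i) S = f (Suc s) (insert i S) + ext_sum f d (Suc s) i (insert i S) +
     ext_sum f (Suc d) s i S"

lemma ext_sum_eq_0: "(\<And>t T. f t T = 0) \<Longrightarrow> ext_sum f d s b S = 0"
  by (induction f d s b S rule: ext_sum.induct) auto

section \<open>Effect of the enumeration on memory and counters\<close>

definition common :: "nat \<Rightarrow> (nat \<Rightarrow> nat \<Rightarrow> bool) \<Rightarrow> nat set \<Rightarrow> nat set" where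
  "common n R S = {u. u < n \<and> (\<forall>i\<in>S. R i u)}"

text \<open>The increment, 0 or 1, that one visited set causes in memory cell \<open>a\<close>. The
  second histogram begins \<open>n + 1\<close> cells after the first, because a number of common
  neighbors lies between 0 and \<open>n\<close>.\<close>

definition hist :: "nat \<Rightarrow> (nat \<Rightarrow> nat \<Rightarrow> bool) \<Rightarrow> nat \<Rightarrow> nat \<Rightarrow> nat set \<Rightarrow> nat" where
  "hist n R a t S = of_bool (a = 1 + n * n + (if odd t then 0 else n + 1) + card (common n R S))"

definition witness :: "nat \<Rightarrow> (nat \<Rightarrow> nat \<Rightarrow> bool) \<Rightarrow> nat \<Rightarrow> nat \<Rightarrow> nat set \<Rightarrow> nat" where
  "witness n R j t S = of_bool (t = j \<and> common n R S \<noteq> {})"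

lemma card_common_eq_0 [simp]: "card (common n R S) = 0 \<longleftrightarrow> common n R S = {}"
  by (simp add: common_def)

text \<open>Induction on the remaining depth \<open>d\<close>. The rows of the chosen vertices are
  given as a set of addresses, without order, because the common neighbors depend on nothing
  else.\<close>

lemma wp_enum_sets:
  assumes "r rZ = 1 + n * n" "r rN = n" "r rOne = 1" "r rNeg = 1 + n * n + (n + 1)" "r rZero = 0"
    and "n \<le> N" "\<And>i u. i < n \<Longrightarrow> u < n \<Longrightarrow> m (1 + i * n + u) \<noteq> 0 \<longleftrightarrow> R i u"
    and "(\<lambda>l. r (regP l)) ` {1..s} = (\<lambda>i. 1 + i * n) ` S" "S \<subseteq> {..<n}"
    and "r (regI s) = b" "r (regP s) = 1 + b * n" "b \<le> n"
    and "\<And>r' m'. (\<And>x. x \<notin> {4..8} \<Longrightarrow> x \<notin> regI ` {s<..} \<Longrightarrow> x \<notin> regP ` {s<..} \<Longrightarrow>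
        x \<notin> range regC \<Longrightarrow> r' x = r x) \<Longrightarrow>
      (\<And>j. r' (regC j) = r (regC j) + ext_sum (witness n R j) d s b S) \<Longrightarrow>
      (\<And>a. m' a = m a + ext_sum (hist n R a) d s b S) \<Longrightarrow> Q (r', m')"
  shows "wp N (enum_sets d s) (r, m) Q"
  using assms
proof (induction d arbitrary: s S b r m Q)
  case 0
  then show ?case by (auto intro!: wp_Skip)
next
  case (Suc d)
  note A = Suc.prems
  let ?r0 = "(r(regI (Suc s) := b))(regP (Suc s) := 1 + b * n)"
  \<comment> \<open>What is already counted plus what the choices below \<open>i\<close> will still
    contribute is constant; this phrasing avoids subtraction.\<close>
  define J where "J i st \<longleftrightarrow>
    (\<forall>x. x \<notin> {4..8} \<longrightarrow> x \<notin> regI ` {s<..} \<longrightarrow> x \<notin> regP ` {s<..} \<longrightarrow> x \<notin> range regC \<longrightarrow> fst st x = r x) \<and>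
    fst st (regI (Suc s)) = i \<and> fst st (regP (Suc s)) = 1 + i * n \<and>
    (\<forall>j. fst st (regC j) + ext_sum (witness n R j) (Suc d) s i S =
       r (regC j) + ext_sum (witness n R j) (Suc d) s b S) \<and>
    (\<forall>a. snd st a + ext_sum (hist n R a) (Suc d) s i S = m a + ext_sum (hist n R a) (Suc d) s b S)"
    for i and st :: state
  \<comment> \<open>Both histograms lie behind the adjacency matrix, so no update touches a matrix
    entry.\<close>
  have hist0: "ext_sum (hist n R (1 + i * n + u)) d' s' b' S' = 0" if "i < n" "u < n" for i u d' s' b' S'
  proof (rule ext_sum_eq_0)
    have "1 + i * n + u < 1 + n * n"
      using mult_le_mono1[of "Suc i" n n] that by simp
    then show "hist n R (1 + i * n + u) t T = 0" for t T
      by (simp add: hist_def)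
  qed
  have step: "wp N (Sub (regI (Suc s)) (regI (Suc s)) rOne ;; Sub (regP (Suc s)) (regP (Suc s)) rN ;;
      record_set (Suc s) ;; enum_sets d (Suc s)) (r', m') (J i)"
    if i: "i < b" and J: "J (Suc i) (r', m')" for i r' m'
  proof -
    have frame: "r' x = r x"
      if "x \<notin> {4..8}" "x \<notin> regI ` {s<..}" "x \<notin> regP ` {s<..}" "x \<notin> range regC" for x
      using J that by (auto simp: J_def)
    have lo: "r' x = r x" if "x \<le> 3 \<or> x = 11" for x
      by (rule frame) (use that in \<open>auto simp: regI_def regP_def regC_def\<close>)
    have reg: "r' (regI (Suc s)) = Suc i" "r' (regP (Suc s)) = 1 + Suc i * n"
      using J by (auto simp: J_def)
    have mat: "m' (1 + j * n + u) = m (1 + j * n + u)" if "j < n" "u < n" for j u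
    proof -
      let ?a = "1 + j * n + u"
      have "m' ?a + ext_sum (hist n R ?a) (Suc d) s (Suc i) S =
          m ?a + ext_sum (hist n R ?a) (Suc d) s b S"
        using J unfolding J_def snd_conv by blast
      then show ?thesis by (simp only: hist0[OF that] add_0_right)
    qed
    let ?r1 = "(r'(regI (Suc s) := i))(regP (Suc s) := 1 + i * n)"
    let ?S = "insert i S"
    have S: "?S \<subseteq> {..<n}" using i A by auto
    have img: "(\<lambda>l. r'' (regP l)) ` {1..Suc s} = (\<lambda>i. 1 + i * n) ` ?S"
      if "\<And>l. r'' (regP l) = ?r1 (regP l)" for r''
    proof -
      have "{1..Suc s} = insert (Suc s) {1..s}" by auto
      moreover have "(\<lambda>l. r'' (regP l)) ` {1..s} = (\<lambda>l. r (regP l)) ` {1..s}"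
        using that by (intro image_cong) (auto intro!: frame)
      moreover have "r'' (regP (Suc s)) = 1 + i * n" using that by simp
      ultimately show ?thesis using A(8) by (simp only: image_insert)
    qed
    have R: "m' (1 + j * n + u) \<noteq> 0 \<longleftrightarrow> R j u" if "j \<in> ?S" "u < n" for j u
      using mat[of j u] A(7)[of j u] S that by auto
    \<comment> \<open>The quantifier over levels becomes one over row addresses, to which the set
      equation \<open>img\<close> applies.\<close>
    have "{u. u < n \<and> (\<forall>l\<in>{1..Suc s}. m' (?r1 (regP l) + u) \<noteq> 0)} =
        {u. u < n \<and> (\<forall>p\<in>(\<lambda>l. ?r1 (regP l)) ` {1..Suc s}. m' (p + u) \<noteq> 0)}"
      by blast
    also have "\<dots> = common n R ?S"
      unfolding img[OF refl] common_def ball_simps using R by blast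
    finally have cnt: "card (common n R ?S) =
        card {u. u < n \<and> (\<forall>l\<in>{1..Suc s}. m' (?r1 (regP l) + u) \<noteq> 0)}" by simp
    define a where "a = 1 + n * n + (if odd (Suc s) then 0 else n + 1) + card (common n R ?S)"
    have "wp N (record_set (Suc s)) (?r1, m') (\<lambda>st. wp N (enum_sets d (Suc s)) st (J i))"
    proof (rule wp_record_set[OF _ _ _ A(6) cnt, where a = a])
      fix r'' assume r'': "\<And>x. x \<notin> {4..8} \<Longrightarrow>
        r'' x = ?r1 x + of_bool (x = regC (Suc s) \<and> card (common n R ?S) \<noteq> 0)"
      have a: "(m'(a := Suc (m' a))) y = m' y + hist n R y (Suc s) ?S" for y
        by (simp add: hist_def a_def)
      have lo2: "r'' x = r x" if "x \<le> 3 \<or> x = 11" for x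
        using r''[of x] lo[of x] that by auto
      have regC: "r'' (regC j) = r' (regC j) + witness n R j (Suc s) ?S" for j
        using r''[of "regC j"] by (auto simp: witness_def)
      have regIP: "r'' (regI (Suc s)) = i" "r'' (regP l) = ?r1 (regP l)" for l
        using r''[of "regI (Suc s)"] r''[of "regP l"] by auto
      show "wp N (enum_sets d (Suc s)) (r'', m'(a := Suc (m' a))) (J i)"
      proof (rule Suc.IH[where S = ?S and b = i])
        show "(m'(a := Suc (m' a))) (1 + j * n + u) \<noteq> 0 \<longleftrightarrow> R j u" if "j < n" "u < n" for j u
        proof -
          have "1 + j * n + u < 1 + n * n" using mult_le_mono1[of "Suc j" n n] that by simp
          then show ?thesis using mat[OF that] A(7)[OF that] by (simp add: a_def)
        qed
        show "(\<lambda>l. r'' (regP l)) ` {1..Suc s} = (\<lambda>i. 1 + i * n) ` ?S"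
          by (rule img[OF regIP(2)])
        fix q k
        assume q: "\<And>x. x \<notin> {4..8} \<Longrightarrow> x \<notin> regI ` {Suc s<..} \<Longrightarrow> x \<notin> regP ` {Suc s<..} \<Longrightarrow>
            x \<notin> range regC \<Longrightarrow> q x = r'' x"
          "\<And>j. q (regC j) = r'' (regC j) + ext_sum (witness n R j) d (Suc s) i ?S"
          "\<And>y. k y = (m'(a := Suc (m' a))) y + ext_sum (hist n R y) d (Suc s) i ?S"
        have "q x = r x"
          if "x \<notin> {4..8}" "x \<notin> regI ` {s<..}" "x \<notin> regP ` {s<..}" "x \<notin> range regC" for x
        proof -
          have "q x = r'' x" by (rule q) (use that in auto)
          also have "\<dots> = r' x" using r''[of x] that by auto
          also have "\<dots> = r x" by (rule frame[OF that])
          finally show ?thesis .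
        qed
        moreover have "q (regI (Suc s)) = i" "q (regP (Suc s)) = 1 + i * n"
          using q(1)[of "regI (Suc s)"] q(1)[of "regP (Suc s)"] regIP by (auto simp: image_iff)
        \<comment> \<open>The third equation of \<open>ext_sum\<close>: \<open>?S\<close> itself has
          been recorded, the inner loops have treated its extensions, and the choices below
          \<open>i\<close> remain.\<close>
        moreover have "q (regC j) + ext_sum (witness n R j) (Suc d) s i S =
            r' (regC j) + ext_sum (witness n R j) (Suc d) s (Suc i) S" for j
          using q(2)[of j] regC[of j] by simp
        moreover have "k y + ext_sum (hist n R y) (Suc d) s i S =
            m' y + ext_sum (hist n R y) (Suc d) s (Suc i) S" for y
          using q(3)[of y] a[of y] by simp
        ultimately show "J i (q, k)" using J by (simp add: J_def del: ext_sum.simps)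
      qed (use A(1-6) lo2 regIP S i A(12) in auto)
    qed (use A(1-6) lo in \<open>auto simp: a_def\<close>)
    then show ?thesis
      using reg lo[of rOne] lo[of rN] A(2,3) by (intro wp_Seq wp_Sub) simp
  qed
  show ?case unfolding enum_sets.simps
  proof (intro wp_Seq wp_Add, rule wp_For[where I = J and n = b])
    show "J b ((r(regI (Suc s) := r (regI s) + r rZero))(regP (Suc s) :=
      (r(regI (Suc s) := r (regI s) + r rZero)) (regP s) + (r(regI (Suc s) := r (regI s) + r rZero)) rZero), m)"
      using A by (auto simp: J_def)
    show "Q (r', m')" if "J 0 (r', m')" for r' m'
      using that by (intro A(13)) (auto simp: J_def)
  qed (use step A(6,12) in \<open>auto simp: J_def\<close>)
qed

section \<open>Binomial sums and output\<close>

text \<open>\<open>taylor h n i\<close> lists the coefficients of \<open>\<Sum>c=i..n. h c * (1 + x)^(c - i)\<close>, so that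
  lowering \<open>i\<close> is a Horner step.\<close>

definition taylor :: "(nat \<Rightarrow> nat) \<Rightarrow> nat \<Rightarrow> nat \<Rightarrow> nat \<Rightarrow> nat" where
  "taylor h n i j = (\<Sum>c=i..n. h c * ((c - i) choose j))"

lemma taylor_0: "i \<le> n \<Longrightarrow> taylor h n i 0 = h i + taylor h n (Suc i) 0"
  unfolding taylor_def by (simp add: sum.atLeast_Suc_atMost)

text \<open>Pascal's rule, after dropping the term \<open>c = i\<close>, whose binomial coefficient
  is \<open>0 choose Suc j = 0\<close>.\<close>

lemma taylor_Suc:
  assumes "i \<le> n"
  shows "taylor h n i (Suc j) = taylor h n (Suc i) j + taylor h n (Suc i) (Suc j)"
proof -
  have "taylor h n i (Suc j) = (\<Sum>c=Suc i..n. h c * ((c - i) choose Suc j))"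
    unfolding taylor_def using assms by (simp add: sum.atLeast_Suc_atMost)
  also have "\<dots> = (\<Sum>c=Suc i..n. h c * ((c - Suc i) choose j) + h c * ((c - Suc i) choose Suc j))"
  proof (rule sum.cong[OF refl])
    fix c assume "c \<in> {Suc i..n}"
    then have "c - i = Suc (c - Suc i)" by auto
    then show "h c * ((c - i) choose Suc j) =
        h c * ((c - Suc i) choose j) + h c * ((c - Suc i) choose Suc j)"
      by (simp add: distrib_left)
  qed
  finally show ?thesis by (simp add: taylor_def sum.distrib)
qed

lemma taylor_eq_0: "n < i + j \<Longrightarrow> taylor h n i j = 0"
  unfolding taylor_def by (intro sum.neutral) (auto simp: binomial_eq_0_iff)

text \<open>Passing from \<open>Suc i\<close> to \<open>i\<close> multiplies the polynomial by
  \<open>1 + x\<close> and adds \<open>h i\<close>. Moving the start of the coefficient array one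
  cell down multiplies by \<open>x\<close> and brings in \<open>h i\<close>, so it remains to add to
  each cell its right neighbor. The last cell gets no summand, for reasons of degree.\<close>

lemma taylor_step:
  fixes h :: "nat \<Rightarrow> nat"
  assumes "i < n"
    and m': "\<And>a. m' a = (if \<beta> + Suc i \<le> a \<and> a \<le> \<beta> + n then taylor h n (Suc i) (a - (\<beta> + Suc i)) else m a)"
    and h: "\<And>c. m (\<beta> + c) = h c"
  shows "(if \<beta> + i \<le> a \<and> a < \<beta> + i + (n - i) then m' a + m' (Suc a) else m' a) =
    (if \<beta> + i \<le> a \<and> a \<le> \<beta> + n then taylor h n i (a - (\<beta> + i)) else m a)"
proof (cases "\<beta> + i \<le> a \<and> a \<le> \<beta> + n")
  case True
  define j where "j = a - (\<beta> + i)"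
  have j: "a = \<beta> + i + j" "i + j \<le> n" using True by (auto simp: j_def)
  have 0: "taylor h n (Suc i) j = 0" if "i + j = n" using that by (intro taylor_eq_0) simp
  show ?thesis
  proof (cases j)
    case 0
    have "m' (\<beta> + i) = h i" "m' (Suc (\<beta> + i)) = taylor h n (Suc i) 0"
      using assms(1) by (simp_all add: m' h)
    then show ?thesis using 0 j assms(1) by (simp add: taylor_0)
  next
    case (Suc k)
    have "m' a = taylor h n (Suc i) k"
      using Suc j by (simp add: m')
    moreover have "m' (Suc a) = taylor h n (Suc i) j" if "a < \<beta> + n"
      using Suc j that by (simp add: m')
    ultimately show ?thesis using Suc j 0 assms(1)
      by (cases "i + j = n") (auto simp: taylor_Suc)
  qed
next
  case False
  then show ?thesis using assms(1) by (auto simp: m')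
qed

section \<open>In-place Taylor shift of a histogram\<close>

definition add_successors :: com where
  "add_successors = While rFlag (Sub rFlag rFlag rOne ;; Load rVal rAddr ;; Add rTmp rAddr rOne ;;
     Load rTmp rTmp ;; Add rVal rVal rTmp ;; Store rAddr rVal ;; Add rAddr rAddr rOne)"

text \<open>Cells are updated from left to right, so the right neighbor read in each round still has
  its old value.\<close>

lemma wp_add_successors:
  assumes "r rFlag = q" "r rAddr = p" "r rOne = 1" "q \<le> N"
    and post: "\<And>r'. (\<And>x. x \<notin> {rFlag, rAddr, rVal, rTmp} \<Longrightarrow> r' x = r x) \<Longrightarrow>
      Q (r', \<lambda>a. if p \<le> a \<and> a < p + q then m a + m (Suc a) else m a)"
  shows "wp N add_successors (r, m) Q"
proof -
  define I where "I i st \<longleftrightarrow> (\<forall>x. x \<notin> {rFlag, rAddr, rVal, rTmp} \<longrightarrow> fst st x = r x) \<and>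
    fst st rFlag = i \<and> i \<le> q \<and> fst st rAddr = p + (q - i) \<and>
    snd st = (\<lambda>a. if p \<le> a \<and> a < p + (q - i) then m a + m (Suc a) else m a)" for i and st :: state
  show ?thesis unfolding add_successors_def
  proof (rule wp_For[where I = I and n = q])
    fix i r' m' assume i: "i < q" and I: "I (Suc i) (r', m')"
    then have f: "r' rFlag = Suc i" "r' rAddr = p + (q - Suc i)" "r' rOne = 1"
      "m' = (\<lambda>a. if p \<le> a \<and> a < p + (q - Suc i) then m a + m (Suc a) else m a)"
      using assms by (auto simp: I_def)
    have g: "q - i = Suc (q - Suc i)" using i by simp
    show "wp N (Sub rFlag rFlag rOne ;; Load rVal rAddr ;; Add rTmp rAddr rOne ;;
     Load rTmp rTmp ;; Add rVal rVal rTmp ;; Store rAddr rVal ;; Add rAddr rAddr rOne) (r', m') (I i)"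
      by (intro wp_intros) (use I i in \<open>auto simp: I_def f g fun_eq_iff\<close>)
  qed (use assms in \<open>auto simp: I_def intro!: post\<close>)
qed

text \<open>Substitutes \<open>1 + x\<close> for \<open>x\<close> in the polynomial with
  coefficients \<open>h c\<close>, so that cell \<open>j\<close> ends up with the sum of
  \<open>h c * (c choose j)\<close>. By Horner's scheme, additions suffice.\<close>

definition taylor_shift :: "nat \<Rightarrow> com" where
  "taylor_shift b = Add rPtr b rN ;; Const rCnt 0 ;; Add rI rN rZero ;;
     While rI (Sub rI rI rOne ;; Sub rPtr rPtr rOne ;; Add rCnt rCnt rOne ;;
       Add rAddr rPtr rZero ;; Add rFlag rCnt rZero ;; add_successors)"

lemma wp_taylor_shift:
  assumes "r rN = n" "r rOne = 1" "r rZero = 0" "n \<le> N" "r b = \<beta>"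
    and post: "\<And>r'. (\<And>x. x \<notin> {4..10} \<Longrightarrow> r' x = r x) \<Longrightarrow>
      Q (r', \<lambda>a. if \<beta> \<le> a \<and> a \<le> \<beta> + n then taylor (\<lambda>c. m (\<beta> + c)) n 0 (a - \<beta>) else m a)"
  shows "wp N (taylor_shift b) (r, m) Q"
proof -
  define I where "I i st \<longleftrightarrow> (\<forall>x. x \<notin> {4..10} \<longrightarrow> fst st x = r x) \<and>
    fst st rI = i \<and> i \<le> n \<and> fst st rPtr = \<beta> + i \<and> fst st rCnt = n - i \<and>
    snd st = (\<lambda>a. if \<beta> + i \<le> a \<and> a \<le> \<beta> + n then taylor (\<lambda>c. m (\<beta> + c)) n i (a - (\<beta> + i)) else m a)"
    for i and st :: state
  show ?thesis unfolding taylor_shift_def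
  proof (intro wp_Seq wp_Add wp_Const, rule wp_For[where I = I and n = n])
    fix i r' m' assume i: "i < n" and I: "I (Suc i) (r', m')"
    then have f: "r' rI = Suc i" "r' rPtr = \<beta> + Suc i" "r' rOne = 1" "r' rCnt = n - Suc i" "r' rZero = 0"
        "\<And>x. x \<notin> {4..10} \<Longrightarrow> r' x = r x"
      and m': "\<And>a. m' a = (if \<beta> + Suc i \<le> a \<and> a \<le> \<beta> + n
        then taylor (\<lambda>c. m (\<beta> + c)) n (Suc i) (a - (\<beta> + Suc i)) else m a)"
      unfolding I_def using assms(1-3) by simp_all
    have g: "n - i = Suc (n - Suc i)" using i by simp
    note mem = taylor_step[OF i m' refl]
    have I': "I i (r'', \<lambda>a. if \<beta> + i \<le> a \<and> a < \<beta> + i + (n - i) then m' a + m' (Suc a) else m' a)"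
      if "\<And>x. x \<notin> {rFlag, rAddr, rVal, rTmp} \<Longrightarrow> r'' x =
        (r'(rI := i, rPtr := \<beta> + i, rCnt := n - i, rAddr := \<beta> + i, rFlag := n - i)) x" for r''
      unfolding mem using i that by (auto simp: I_def f)
    show "wp N (Sub rI rI rOne ;; Sub rPtr rPtr rOne ;; Add rCnt rCnt rOne ;;
       Add rAddr rPtr rZero ;; Add rFlag rCnt rZero ;; add_successors) (r', m') (I i)"
      by (intro wp_Seq wp_Sub wp_Add, rule wp_add_successors[where p = "\<beta> + i" and q = "n - i"];
          (rule I')?; use i assms(4) in \<open>simp add: f g\<close>)
  next
    show "Q (r', m')" if "I 0 (r', m')" for r' m'
      using that post[of r'] by (auto simp: I_def cong: if_cong)
  \<comment> \<open>For \<open>i = n\<close> the only listed coefficient is \<open>h n\<close>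
    itself, so the untouched memory satisfies the invariant.\<close>
  qed (use assms(1-5) in \<open>auto simp: I_def fun_eq_iff taylor_def\<close>)
qed

section \<open>Assembling the output word\<close>

primrec store_small :: "nat \<Rightarrow> com" where
  "store_small 0 = Store rZero rOne"
| "store_small (Suc s) = store_small s ;; Const rAddr (Suc s) ;; Store rAddr (regC (Suc s))"

text \<open>The loops never visit the empty set, so its coefficient 1 is written explicitly.\<close>

lemma wp_store_small:
  assumes "r rOne = 1" "r rZero = 0"
    and "\<And>r'. (\<And>x. x \<noteq> rAddr \<Longrightarrow> r' x = r x) \<Longrightarrow>
      Q (r', \<lambda>a. if a = 0 then 1 else if a \<le> k then r (regC a) else m a)"
  shows "wp N (store_small k) (r, m) Q"
  using assms(3)
proof (induction k arbitrary: Q)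
  case 0
  have "m(0 := 1) = (\<lambda>a. if a = 0 then 1 else if a \<le> 0 then r (regC a) else m a)" by auto
  with 0 assms show ?case by (auto intro!: wp_Store)
next
  case (Suc k)
  have "(\<lambda>a. if a = 0 then 1 else if a \<le> k then r (regC a) else m a)(Suc k := r (regC (Suc k))) =
      (\<lambda>a. if a = 0 then 1 else if a \<le> Suc k then r (regC a) else m a)" by (auto simp: le_Suc_eq)
  with Suc.prems show ?case unfolding store_small.simps
    by (intro wp_Seq Suc.IH wp_Const wp_Store) simp
qed

text \<open>In the application, truncated subtraction is exact at indices above \<open>k\<close>,
  where the odd sum exceeds the even one by a cardinality; \<open>store_small\<close> afterwards
  overwrites the entries up to \<open>k\<close>.\<close>

definition write_difference :: com where
  "write_difference = Add rI rN rOne ;; While rI (Sub rI rI rOne ;; Add rAddr rZ rI ;;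
     Load rVal rAddr ;; Add rAddr rNeg rI ;; Load rTmp rAddr ;; Sub rVal rVal rTmp ;; Store rI rVal)"

text \<open>\<open>n < r rZ\<close> and \<open>n < r rNeg\<close> keep the output cells clear of the
  histograms still being read. There are \<open>n + 1\<close> rounds, one per coefficient.\<close>

lemma wp_write_difference:
  assumes "r rN = n" "r rOne = 1" "n < r rZ" "n < r rNeg" "n < N"
    and post: "\<And>r'. (\<And>x. x \<notin> {4..10} \<Longrightarrow> r' x = r x) \<Longrightarrow>
      Q (r', \<lambda>a. if a \<le> n then m (r rZ + a) - m (r rNeg + a) else m a)"
  shows "wp N write_difference (r, m) Q"
proof -
  define I where "I i st \<longleftrightarrow> (\<forall>x. x \<notin> {4..10} \<longrightarrow> fst st x = r x) \<and> fst st rI = i \<and>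
    snd st = (\<lambda>a. if i \<le> a \<and> a \<le> n then m (r rZ + a) - m (r rNeg + a) else m a)"
    for i and st :: state
  show ?thesis unfolding write_difference_def
  proof (intro wp_Seq wp_Add, rule wp_For[where I = I and n = "Suc n"])
    fix i r' m' assume i: "i < Suc n" and I: "I (Suc i) (r', m')"
    then have f: "r' rI = Suc i" "r' rOne = 1" "r' rZ = r rZ" "r' rNeg = r rNeg"
      and m': "m' = (\<lambda>a. if Suc i \<le> a \<and> a \<le> n then m (r rZ + a) - m (r rNeg + a) else m a)"
      using assms by (auto simp: I_def)
    show "wp N (Sub rI rI rOne ;; Add rAddr rZ rI ;; Load rVal rAddr ;; Add rAddr rNeg rI ;;
        Load rTmp rAddr ;; Sub rVal rVal rTmp ;; Store rI rVal) (r', m') (I i)"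
      by (intro wp_intros) (use I i assms(3,4) in \<open>auto simp: I_def f m' fun_eq_iff\<close>)
  next
    show "Q (r', m')" if "I 0 (r', m')" for r' m'
      using that post[of r'] by (auto simp: I_def)
  qed (use assms(1-5) in \<open>auto simp: I_def fun_eq_iff\<close>)
qed

text \<open>The complex is closed under subsets, so the nonzero coefficients form an initial segment
  and their number is the length of \<open>coeffs\<close>.\<close>

definition count_nonzero :: com where
  "count_nonzero = Const rZ 0 ;; Add rI rN rOne ;;
     While rI (Sub rI rI rOne ;; Load rVal rI ;; If rVal (Add rZ rZ rOne) Skip)"

lemma wp_count_nonzero:
  assumes "r rN = n" "r rOne = 1" "n < N"
    and post: "\<And>r'. r' rZ = card {a. a \<le> n \<and> m a \<noteq> 0} \<Longrightarrow> Q (r', m)"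
  shows "wp N count_nonzero (r, m) Q"
proof -
  define I where "I i st \<longleftrightarrow> fst st rOne = 1 \<and> fst st rI = i \<and> snd st = m \<and>
    fst st rZ = card {a. i \<le> a \<and> a \<le> n \<and> m a \<noteq> 0}" for i and st :: state
  have card: "card {a. i \<le> a \<and> a \<le> n \<and> m a \<noteq> 0} =
      card {a. Suc i \<le> a \<and> a \<le> n \<and> m a \<noteq> 0} + of_bool (m i \<noteq> 0)" if "i \<le> n" for i
  proof -
    have "{a. i \<le> a \<and> a \<le> n \<and> m a \<noteq> 0} =
       {a. Suc i \<le> a \<and> a \<le> n \<and> m a \<noteq> 0} \<union> (if m i \<noteq> 0 then {i} else {})"
      using that le_eq_less_or_eq by (auto simp: Suc_le_eq)
    then show ?thesis by simp
  qed
  show ?thesis unfolding count_nonzero_def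
  proof (intro wp_Seq wp_Add wp_Const, rule wp_For[where I = I and n = "Suc n"])
    fix i r' m' assume i: "i < Suc n" and I: "I (Suc i) (r', m')"
    then show "wp N (Sub rI rI rOne ;; Load rVal rI ;; If rVal (Add rZ rZ rOne) Skip) (r', m') (I i)"
      using card[of i] by (intro wp_intros) (auto simp: I_def)
  qed (use assms(1-3) in \<open>auto simp: I_def intro!: post\<close>)
qed

definition finish :: "nat \<Rightarrow> com" where
  "finish k = taylor_shift rZ ;; taylor_shift rNeg ;; write_difference ;; store_small k ;; count_nonzero"

lemma wp_finish:
  assumes r: "r rN = n" "r rOne = 1" "r rZero = 0" "r rZ = z" "r rNeg = z + (n + 1)"
    and "n < z" "k \<le> n" "n < N"
    and out: "\<And>j. out j = (if j = 0 then 1 else if j \<le> k then r (regC j) else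
        taylor (\<lambda>c. m (z + c)) n 0 j - taylor (\<lambda>c. m (z + (n + 1) + c)) n 0 j)"
    and post: "\<And>r' m'. (\<And>j. j \<le> n \<Longrightarrow> m' j = out j) \<Longrightarrow>
      r' rZ = card {j. j \<le> n \<and> out j \<noteq> 0} \<Longrightarrow> Q (r', m')"
  shows "wp N (finish k) (r, m) Q"
  unfolding finish_def
proof (rule wp_Seq, rule wp_taylor_shift[OF r(1-3) _ r(4)])
  fix r2 assume r2: "\<And>x. x \<notin> {4..10} \<Longrightarrow> r2 x = r x"
  let ?m2 = "\<lambda>a. if z \<le> a \<and> a \<le> z + n then taylor (\<lambda>c. m (z + c)) n 0 (a - z) else m a"
  show "wp N (taylor_shift rNeg ;; write_difference ;; store_small k ;; count_nonzero) (r2, ?m2) Q"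
  proof (rule wp_Seq, rule wp_taylor_shift[where n = n and \<beta> = "z + (n + 1)"])
    fix r3 assume r3: "\<And>x. x \<notin> {4..10} \<Longrightarrow> r3 x = r2 x"
    let ?m3 = "\<lambda>a. if z + (n + 1) \<le> a \<and> a \<le> z + (n + 1) + n
      then taylor (\<lambda>c. ?m2 (z + (n + 1) + c)) n 0 (a - (z + (n + 1))) else ?m2 a"
    have eq3: "r3 x = r x" if "x \<notin> {4..10}" for x using r2 r3 that by simp
    show "wp N (write_difference ;; store_small k ;; count_nonzero) (r3, ?m3) Q"
    proof (rule wp_Seq, rule wp_write_difference[where n = n])
      fix r4 assume r4: "\<And>x. x \<notin> {4..10} \<Longrightarrow> r4 x = r3 x"
      let ?m4 = "\<lambda>a. if a \<le> n then ?m3 (r3 rZ + a) - ?m3 (r3 rNeg + a) else ?m3 a"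
      have eq4: "r4 x = r x" if "x \<notin> {4..10}" for x using eq3 r4 that by simp
      show "wp N (store_small k ;; count_nonzero) (r4, ?m4) Q"
      proof (rule wp_Seq, rule wp_store_small)
        fix r5 assume r5: "\<And>x. x \<noteq> rAddr \<Longrightarrow> r5 x = r4 x"
        let ?m5 = "\<lambda>a. if a = 0 then 1 else if a \<le> k then r4 (regC a) else ?m4 a"
        have eq5: "r5 x = r x" if "x \<notin> {4..10}" for x using eq4[of x] r5[of x] that by auto
        have m5: "?m5 j = out j" if "j \<le> n" for j
          using that eq3[of rZ] eq3[of rNeg] eq4[of "regC j"] r assms(6) by (simp add: out)
        show "wp N count_nonzero (r5, ?m5) Q"
        proof (rule wp_count_nonzero[where n = n])
          fix r6 assume "r6 rZ = card {a. a \<le> n \<and> ?m5 a \<noteq> 0}"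
          also have "{a. a \<le> n \<and> ?m5 a \<noteq> 0} = {j. j \<le> n \<and> out j \<noteq> 0}"
            using m5 by (intro Collect_cong conj_cong refl) (simp only:)
          finally show "Q (r6, ?m5)" by (rule post[rotated]) (rule m5)
        qed (use eq5 r assms(8) in auto)
      qed (use eq4 r in auto)
    qed (use eq3 r assms(6-8) in auto)
  qed (use r2 r assms(8) in auto)
qed (use assms(8) in auto)

text \<open>Level 0 is a sentinel holding the nonexistent vertex \<open>n\<close>. Its row would
  begin at \<open>1 + n * n\<close>, which is exactly the input length and thus available without
  multiplication.\<close>

definition setup_regs :: com where
  "setup_regs = Load rN rZero ;; Const rOne 1 ;; Add rNeg rZ rN ;; Add rNeg rNeg rOne ;;
     Add (regI 0) rN rZero ;; Add (regP 0) rZ rZero"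

lemma wp_setup_regs:
  assumes "\<And>r. r rZ = z \<Longrightarrow> r rN = m 0 \<Longrightarrow> r rOne = 1 \<Longrightarrow> r rNeg = z + (m 0 + 1) \<Longrightarrow> r rZero = 0 \<Longrightarrow>
     r (regI 0) = m 0 \<Longrightarrow> r (regP 0) = z \<Longrightarrow> (\<And>j. r (regC j) = 0) \<Longrightarrow> Q (r, m)"
  shows "wp N setup_regs ((\<lambda>_. 0)(0 := z), m) Q"
  unfolding setup_regs_def by (intro wp_intros assms) auto

section \<open>The complete program\<close>

definition nbr_poly_prog :: "nat \<Rightarrow> com" where
  "nbr_poly_prog k = setup_regs ;; enum_sets k 0 ;; finish k"

definition out_coeff :: "nat \<Rightarrow> nat \<Rightarrow> (nat \<Rightarrow> nat \<Rightarrow> bool) \<Rightarrow> nat \<Rightarrow> nat" where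
  "out_coeff k n R j =
    (if j = 0 then 1 else if j \<le> k then ext_sum (witness n R j) k 0 n {} else
      taylor (\<lambda>c. ext_sum (hist n R (1 + n * n + c)) k 0 n {}) n 0 j -
      taylor (\<lambda>c. ext_sum (hist n R (1 + n * n + (n + 1) + c)) k 0 n {}) n 0 j)"

text \<open>Here \<open>R\<close> is an arbitrary relation read off the matrix; symmetry and
  degeneracy come in afterwards. The iteration bound \<open>n + 1\<close> stems from the loops over
  all coefficients.\<close>

lemma wp_nbr_poly_prog:
  assumes len: "length w = 1 + n * n" and w0: "w ! 0 = n" and "k < n"
    and R: "\<And>i u. i < n \<Longrightarrow> u < n \<Longrightarrow> w ! (1 + i * n + u) \<noteq> 0 \<longleftrightarrow> R i u"
  shows "wp (n + 1) (nbr_poly_prog k) (initial_state w) (\<lambda>s. output_of s =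
    map (out_coeff k n R) [0..<card {j. j \<le> n \<and> out_coeff k n R j \<noteq> 0}])" (is "wp _ _ _ ?Q")
proof -
  define m where "m = (\<lambda>i. if i < length w then w ! i else 0)"
  \<comment> \<open>Memory behind the input is 0, so both histograms start empty.\<close>
  have m: "m 0 = n" "\<And>i u. i < n \<Longrightarrow> u < n \<Longrightarrow> m (1 + i * n + u) \<noteq> 0 \<longleftrightarrow> R i u"
    "\<And>c. m (1 + n * n + c) = 0"
  proof -
    show "m (1 + i * n + u) \<noteq> 0 \<longleftrightarrow> R i u" if "i < n" "u < n" for i u
      using mult_le_mono1[of "Suc i" n n] that R[OF that] len by (simp add: m_def)
  qed (use len w0 in \<open>auto simp: m_def\<close>)
  show ?thesis unfolding initial_state_def nbr_poly_prog_def m_def[symmetric]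
  proof (rule wp_Seq, rule wp_setup_regs, rule wp_Seq)
    fix r assume r: "r rZ = length w" "r rN = m 0" "r rOne = 1" "r rNeg = length w + (m 0 + 1)"
      "r rZero = 0" "r (regI 0) = m 0" "r (regP 0) = length w" "\<And>j. r (regC j) = 0"
    show "wp (n + 1) (enum_sets k 0) (r, m) (\<lambda>s. wp (n + 1) (finish k) s ?Q)"
    proof (rule wp_enum_sets[where n = n and R = R and b = n and S = "{}"])
      fix r1 m1
      assume r1: "\<And>x. x \<notin> {4..8} \<Longrightarrow> x \<notin> regI ` {0<..} \<Longrightarrow> x \<notin> regP ` {0<..} \<Longrightarrow>
          x \<notin> range regC \<Longrightarrow> r1 x = r x"
        and c1: "\<And>j. r1 (regC j) = r (regC j) + ext_sum (witness n R j) k 0 n {}"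
        and m1: "\<And>a. m1 a = m a + ext_sum (hist n R a) k 0 n {}"
      have lo: "r1 x = r x" if "x \<in> {rZ, rN, rOne, rNeg, rZero}" for x
        by (rule r1) (use that in auto)
      have H: "m1 (1 + n * n + c) = ext_sum (hist n R (1 + n * n + c)) k 0 n {}"
        "m1 (1 + n * n + (n + 1) + c) = ext_sum (hist n R (1 + n * n + (n + 1) + c)) k 0 n {}" for c
        using m1 m(3)[of c] m(3)[of "n + 1 + c"] by (simp_all only: add.assoc add_0)
      show "wp (n + 1) (finish k) (r1, m1) ?Q"
      proof (rule wp_finish[where n = n and z = "1 + n * n" and out = "out_coeff k n R"])
        show "out_coeff k n R j = (if j = 0 then 1 else if j \<le> k then r1 (regC j) else
            taylor (\<lambda>c. m1 (1 + n * n + c)) n 0 j - taylor (\<lambda>c. m1 (1 + n * n + (n + 1) + c)) n 0 j)" for j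
          unfolding out_coeff_def H by (simp add: c1 r)
      next
        fix r' m'
        assume out: "\<And>j. j \<le> n \<Longrightarrow> m' j = out_coeff k n R j"
          and card: "r' rZ = card {j. j \<le> n \<and> out_coeff k n R j \<noteq> 0}"
        have "card {j. j \<le> n \<and> out_coeff k n R j \<noteq> 0} \<le> card {..n}"
          by (intro card_mono) auto
        then show "?Q (r', m')"
          using card by (auto simp: output_of_def out)
      qed (use r len m \<open>k < n\<close> lo in \<open>auto simp: less_Suc_eq_le\<close>)
    qed (use r len m in auto)
  qed
qed

section \<open>Counting sets with a common neighbor\<close>

definition small_sets :: "nat \<Rightarrow> nat \<Rightarrow> nat set set" where
  "small_sets d b = {U. U \<subseteq> {..<b} \<and> U \<noteq> {} \<and> card U \<le> d}"

lemma finite_small_sets [simp]: "finite (small_sets d b)"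
  by (rule finite_subset[of _ "Pow {..<b}"]) (auto simp: small_sets_def)

lemma small_sets_0 [simp]: "small_sets 0 b = {}" "small_sets d 0 = {}"
  by (auto simp: small_sets_def dest: finite_subset)

text \<open>Case distinction on the largest admissible vertex \<open>i\<close>: \<open>U\<close> is
  \<open>{i}\<close>, or \<open>i\<close> together with a nonempty set below it, or avoids
  \<open>i\<close>. These are the three summands of \<open>ext_sum\<close>.\<close>

lemma small_sets_Suc:
  "small_sets (Suc d) (Suc i) = insert {i} (insert i ` small_sets d i) \<union> small_sets (Suc d) i"
proof (intro subset_antisym subsetI)
  fix U assume U: "U \<in> small_sets (Suc d) (Suc i)"
  then have fin: "finite U" by (auto simp: small_sets_def dest: finite_subset)
  show "U \<in> insert {i} (insert i ` small_sets d i) \<union> small_sets (Suc d) i"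
  proof (cases "i \<in> U")
    case True
    define U' where "U' = U - {i}"
    have *: "U = insert i U'" "card U = Suc (card U')" "U' \<subseteq> {..<i}"
      unfolding U'_def
    proof -
      show "U = insert i (U - {i})" using True by blast
      show "card U = Suc (card (U - {i}))" by (rule card.remove[OF fin True])
      show "U - {i} \<subseteq> {..<i}"
        using U unfolding small_sets_def lessThan_Suc by blast
    qed
    show ?thesis
    proof (cases "U' = {}")
      case False
      then have "U' \<in> small_sets d i" using * U by (simp add: small_sets_def)
      with * show ?thesis by blast
    qed (use * in simp)
  next
    case False
    then show ?thesis using U unfolding small_sets_def lessThan_Suc by blast
  qed
next
  fix U assume "U \<in> insert {i} (insert i ` small_sets d i) \<union> small_sets (Suc d) i"
  then consider "U = {i}" | U' where "U = insert i U'" "U' \<in> small_sets d i"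
    | "U \<in> small_sets (Suc d) i" by blast
  then show "U \<in> small_sets (Suc d) (Suc i)"
  proof cases
    case (2 U')
    have "card (insert i U') \<le> Suc (card U')" by (rule card_insert_le_m1) simp_all
    with 2 show ?thesis unfolding small_sets_def lessThan_Suc by auto
  qed (auto simp: small_sets_def lessThan_Suc)
qed

text \<open>\<open>S\<close> is disjoint from \<open>{..<b}\<close>, so each inserted vertex is new
  and the tracked size remains the cardinality.\<close>

lemma ext_sum_eq:
  "finite S \<Longrightarrow> S \<inter> {..<b} = {} \<Longrightarrow> s = card S \<Longrightarrow>
   ext_sum f d s b S = (\<Sum>U\<in>small_sets d b. f (card (S \<union> U)) (S \<union> U))"
proof (induction f d s b S rule: ext_sum.induct)
  case (3 f d s i S)
  let ?g = "\<lambda>U. f (card (S \<union> U)) (S \<union> U)"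
  have i: "i \<notin> S" "insert i S \<inter> {..<i} = {}" "S \<inter> {..<i} = {}" using 3 by auto
  have inj: "inj_on (insert i) (small_sets d i)"
  proof (rule inj_onI)
    fix U W assume "U \<in> small_sets d i" "W \<in> small_sets d i" "insert i U = insert i W"
    moreover from this have "i \<notin> U" "i \<notin> W" by (auto simp: small_sets_def)
    ultimately show "U = W" by (simp add: insert_ident)
  qed
  have "(\<Sum>U\<in>small_sets (Suc d) (Suc i). ?g U) =
      ?g {i} + (\<Sum>U\<in>insert i ` small_sets d i. ?g U) + (\<Sum>U\<in>small_sets (Suc d) i. ?g U)"
    unfolding small_sets_Suc
    by (subst sum.union_disjoint) (auto simp: small_sets_def sum.insert_if)
  also have "(\<Sum>U\<in>insert i ` small_sets d i. ?g U) = (\<Sum>U\<in>small_sets d i. ?g (insert i U))"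
    by (simp add: sum.reindex[OF inj] o_def)
  finally show ?case using 3 i by (simp add: card_insert_if)
qed auto

lemma ext_sum_empty: "ext_sum f k 0 n {} = (\<Sum>U\<in>small_sets k n. f (card U) U)"
  by (simp add: ext_sum_eq)

section \<open>Histograms as sums over vertex sets\<close>

lemma card_common_le: "card (common n R U) \<le> n"
  using card_mono[of "{..<n}" "common n R U"] by (auto simp: common_def)

text \<open>Swap the sums over values \<open>c\<close> and objects \<open>U\<close>: each
  \<open>U\<close> with \<open>P U\<close> is counted in exactly one histogram entry, the one for
  \<open>g U\<close>.\<close>

lemma taylor_sum:
  assumes "\<And>c. c \<le> n \<Longrightarrow> h c = (\<Sum>U\<in>X. of_bool (c = g U \<and> P U))" "\<And>U. U \<in> X \<Longrightarrow> g U \<le> n"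
  shows "taylor h n 0 j = (\<Sum>U\<in>X. of_bool (P U) * (g U choose j))"
proof -
  have "taylor h n 0 j = (\<Sum>c=0..n. \<Sum>U\<in>X. of_bool (c = g U \<and> P U) * (c choose j))"
    unfolding taylor_def by (intro sum.cong) (auto simp: assms(1) sum_distrib_right)
  also have "\<dots> = (\<Sum>U\<in>X. \<Sum>c=0..n. of_bool (c = g U \<and> P U) * (c choose j))"
    by (rule sum.swap)
  also have "\<dots> = (\<Sum>U\<in>X. of_bool (P U) * (g U choose j))"
  proof (rule sum.cong[OF refl])
    fix U assume "U \<in> X"
    then have "(\<Sum>c=0..n. of_bool (c = g U \<and> P U) * (c choose j)) =
        (\<Sum>c\<in>{g U}. of_bool (c = g U \<and> P U) * (c choose j))"
      by (intro sum.mono_neutral_right) (auto simp: assms(2))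
    then show "(\<Sum>c=0..n. of_bool (c = g U \<and> P U) * (c choose j)) = of_bool (P U) * (g U choose j)"
      by simp
  qed
  finally show ?thesis .
qed

text \<open>Cells of the first histogram have offset at most \<open>n\<close>, updates for even sets
  at least \<open>n + 1\<close>, so even sets contribute nothing.\<close>

lemma taylor_odd:
  "taylor (\<lambda>c. ext_sum (hist n R (1 + n * n + c)) k 0 n {}) n 0 j =
    (\<Sum>U\<in>small_sets k n. of_bool (odd (card U)) * (card (common n R U) choose j))"
proof (rule taylor_sum)
  fix c assume "c \<le> n"
  then show "ext_sum (hist n R (1 + n * n + c)) k 0 n {} =
      (\<Sum>U\<in>small_sets k n. of_bool (c = card (common n R U) \<and> odd (card U)))"
    unfolding ext_sum_empty hist_def by (intro sum.cong) auto
qed (rule card_common_le)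

lemma taylor_even:
  "taylor (\<lambda>c. ext_sum (hist n R (1 + n * n + (n + 1) + c)) k 0 n {}) n 0 j =
    (\<Sum>U\<in>small_sets k n. of_bool (even (card U)) * (card (common n R U) choose j))"
proof (rule taylor_sum)
  fix c assume "c \<le> n"
  \<comment> \<open>An odd set would need more than \<open>n\<close> common neighbors to reach the
    second histogram.\<close>
  have "n + 1 + c \<noteq> card (common n R U)" for U
    using card_common_le[of n R U] by simp
  then show "ext_sum (hist n R (1 + n * n + (n + 1) + c)) k 0 n {} =
      (\<Sum>U\<in>small_sets k n. of_bool (c = card (common n R U) \<and> even (card U)))"
    unfolding ext_sum_empty hist_def by (intro sum.cong) auto
qed (rule card_common_le)

section \<open>Inclusion-exclusion over common neighbors\<close>

definition bounded_sets :: "nat \<Rightarrow> (nat \<Rightarrow> nat \<Rightarrow> bool) \<Rightarrow> nat \<Rightarrow> nat set set" where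
  "bounded_sets n R j = {A. A \<subseteq> {..<n} \<and> card A = j \<and> common n R A \<noteq> {}}"

text \<open>A nonempty finite set has as many even as odd subsets; leaving out the empty one costs
  the even side one.\<close>

lemma odd_subsets_eq_Suc_even:
  assumes "finite C" "C \<noteq> {}"
  shows "card {U. U \<subseteq> C \<and> U \<noteq> {} \<and> odd (card U)} = Suc (card {U. U \<subseteq> C \<and> U \<noteq> {} \<and> even (card U)})"
proof -
  have "{U. U \<subseteq> C \<and> U \<noteq> {} \<and> odd (card U)} = {U. U \<subseteq> C \<and> {} \<subseteq> U \<and> odd (card U)}"
    by (rule Collect_cong) auto
  also have "card \<dots> = card {U. U \<subseteq> C \<and> {} \<subseteq> U \<and> even (card U)}"
    by (rule card_subsupersets_even_odd[symmetric]) (use assms in blast)+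
  also have "{U. U \<subseteq> C \<and> {} \<subseteq> U \<and> even (card U)} = insert {} {U. U \<subseteq> C \<and> U \<noteq> {} \<and> even (card U)}"
    by (rule set_eqI) auto
  finally show ?thesis using assms by simp
qed

text \<open>Double counting of pairs of a set \<open>A\<close> of size \<open>j\<close> and a small
  \<open>U\<close> inside its common neighborhood, separately for each parity of
  \<open>card U\<close>. As \<open>j > k\<close>, \<open>free\<close> makes all nonempty subsets of
  that neighborhood small, so for fixed \<open>A\<close> the two parities differ by one exactly if
  \<open>A\<close> has a common neighbor.\<close>

lemma inclusion_exclusion_common:
  assumes sym: "\<And>i u. i < n \<Longrightarrow> u < n \<Longrightarrow> R i u \<longleftrightarrow> R u i"
    and free: "\<And>A. A \<subseteq> {..<n} \<Longrightarrow> k < card A \<Longrightarrow> card (common n R A) \<le> k"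
    and "k < j"
  shows "(\<Sum>U\<in>small_sets k n. of_bool (odd (card U)) * (card (common n R U) choose j)) =
    card (bounded_sets n R j) +
    (\<Sum>U\<in>small_sets k n. of_bool (even (card U)) * (card (common n R U) choose j))"
proof -
  let ?Y = "{A. A \<subseteq> {..<n} \<and> card A = j}"
  have finY: "finite ?Y" by (rule finite_subset[of _ "Pow {..<n}"]) auto
  have fin: "finite (common n R A)" for A by (simp add: common_def)
  \<comment> \<open>By symmetry of \<open>R\<close>, both inclusions say that every element of
    \<open>A\<close> is related to every element of \<open>U\<close>.\<close>
  have swap: "A \<subseteq> common n R U \<longleftrightarrow> U \<subseteq> common n R A" if "A \<subseteq> {..<n}" "U \<subseteq> {..<n}" for A U
  proof -
    have "R u a \<longleftrightarrow> R a u" if "u \<in> U" "a \<in> A" for u a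
      using sym that \<open>A \<subseteq> {..<n}\<close> \<open>U \<subseteq> {..<n}\<close> by blast
    then show ?thesis using that unfolding common_def by blast
  qed
  have double: "(\<Sum>U\<in>small_sets k n. of_bool (P U) * (card (common n R U) choose j)) =
      (\<Sum>A\<in>?Y. card {U. U \<subseteq> common n R A \<and> U \<noteq> {} \<and> P U})" for P
  proof -
    have "(\<Sum>U\<in>small_sets k n. of_bool (P U) * (card (common n R U) choose j)) =
        (\<Sum>U\<in>small_sets k n. \<Sum>A\<in>?Y. of_bool (P U \<and> U \<subseteq> common n R A))"
    proof (rule sum.cong[OF refl])
      fix U assume U: "U \<in> small_sets k n"
      have "card (common n R U) choose j = card {A. A \<subseteq> common n R U \<and> card A = j}"
        by (simp add: n_subsets[OF fin])
      also have "{A. A \<subseteq> common n R U \<and> card A = j} = ?Y \<inter> {A. U \<subseteq> common n R A}"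
      proof -
        have "common n R U \<subseteq> {..<n}" by (auto simp: common_def)
        then show ?thesis using swap U unfolding small_sets_def by blast
      qed
      finally show "of_bool (P U) * (card (common n R U) choose j) =
          (\<Sum>A\<in>?Y. of_bool (P U \<and> U \<subseteq> common n R A))"
        using finY by (simp add: sum_of_bool_eq)
    qed
    also have "\<dots> = (\<Sum>A\<in>?Y. \<Sum>U\<in>small_sets k n. of_bool (P U \<and> U \<subseteq> common n R A))"
      by (rule sum.swap)
    also have "\<dots> = (\<Sum>A\<in>?Y. card {U. U \<subseteq> common n R A \<and> U \<noteq> {} \<and> P U})"
    proof (rule sum.cong[OF refl])
      fix A assume A: "A \<in> ?Y"
      have "card U \<le> k" if "U \<subseteq> common n R A" for U
        using free[of A] A \<open>k < j\<close> card_mono[OF fin that] by auto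
      moreover have "common n R A \<subseteq> {..<n}" by (auto simp: common_def)
      ultimately have "small_sets k n \<inter> {U. P U \<and> U \<subseteq> common n R A} =
          {U. U \<subseteq> common n R A \<and> U \<noteq> {} \<and> P U}"
        unfolding small_sets_def by blast
      then show "(\<Sum>U\<in>small_sets k n. of_bool (P U \<and> U \<subseteq> common n R A)) =
          card {U. U \<subseteq> common n R A \<and> U \<noteq> {} \<and> P U}"
        by (simp add: sum_of_bool_eq)
    qed
    finally show ?thesis .
  qed
  have "card {U. U \<subseteq> common n R A \<and> U \<noteq> {} \<and> odd (card U)} =
      of_bool (common n R A \<noteq> {}) + card {U. U \<subseteq> common n R A \<and> U \<noteq> {} \<and> even (card U)}" for A
  proof (cases "common n R A = {}")
    case False
    then show ?thesis using odd_subsets_eq_Suc_even[OF fin False] by simp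
  next
    case True
    have "{U. U \<subseteq> {} \<and> U \<noteq> {} \<and> P U} = {}" for P :: "nat set \<Rightarrow> bool" by auto
    then show ?thesis unfolding True by (simp only: card.empty) simp
  qed
  moreover have "?Y \<inter> {A. common n R A \<noteq> {}} = bounded_sets n R j"
    by (auto simp: bounded_sets_def)
  ultimately show ?thesis
    unfolding double using finY by (simp only: sum.distrib sum_of_bool_eq of_nat_id)
qed

lemma out_coeff_eq:
  assumes "\<And>i u. i < n \<Longrightarrow> u < n \<Longrightarrow> R i u \<longleftrightarrow> R u i"
    and "\<And>A. A \<subseteq> {..<n} \<Longrightarrow> k < card A \<Longrightarrow> card (common n R A) \<le> k"
    and "0 < n"
  shows "out_coeff k n R j = card (bounded_sets n R j)"
proof -
  consider "j = 0" | "0 < j" "j \<le> k" | "k < j" by linarith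
  then show ?thesis
  proof cases
    case 1
    \<comment> \<open>Every vertex is a common neighbor of the empty set, and by
      \<open>0 < n\<close> there is one.\<close>
    have "bounded_sets n R 0 = {{}}"
      using assms(3) by (auto simp: bounded_sets_def common_def dest: finite_subset)
    then show ?thesis using 1 by (simp add: out_coeff_def)
  next
    case 2
    have "small_sets k n \<inter> {U. card U = j \<and> common n R U \<noteq> {}} = bounded_sets n R j"
      using 2 by (auto simp: small_sets_def bounded_sets_def)
    then show ?thesis using 2
      by (simp add: out_coeff_def ext_sum_empty witness_def sum_of_bool_eq)
  next
    case 3
    then show ?thesis
      using inclusion_exclusion_common[OF assms(1,2) 3]
      by (simp only: out_coeff_def taylor_odd taylor_even) simp
  qed
qed

section \<open>From graphs to words\<close>

text \<open>In the subgraph induced by \<open>A \<union> B\<close>, each vertex of one side is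
  joined to the whole other side, so all degrees exceed \<open>k\<close>.\<close>

lemma degenerate_no_biclique:
  assumes "simple_graph V E" "degenerate k V E" "A \<subseteq> V" "B \<subseteq> V" "k < card A" "k < card B"
    and edges: "\<And>a b. a \<in> A \<Longrightarrow> b \<in> B \<Longrightarrow> {a, b} \<in> E"
  shows False
proof -
  define F where "F = {e \<in> E. e \<subseteq> A \<union> B}"
  have fin: "finite V" using assms(1) by (simp add: simple_graph_def)
  have "subgraph (A \<union> B) F V E"
    unfolding subgraph_def simple_graph_def
  proof (intro conjI ballI)
    show "finite (A \<union> B)" by (rule finite_subset[OF _ fin]) (use assms(3,4) in blast)
    show "card e = 2" if "e \<in> F" for e
      using that assms(1) by (simp add: simple_graph_def F_def)
  qed (use assms(3,4) in \<open>auto simp: F_def\<close>)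
  moreover have "A \<union> B \<noteq> {}" using assms(5) by auto
  ultimately obtain v where v: "v \<in> A \<union> B" "degree_in (A \<union> B) F v \<le> k"
    using assms(2) unfolding degenerate_def by blast
  have fin': "finite (neighborhood (A \<union> B) F v)"
    by (rule finite_subset[OF _ fin]) (use assms(3,4) in \<open>auto simp: neighborhood_def\<close>)
  have "C \<subseteq> neighborhood (A \<union> B) F v \<Longrightarrow> k < card C \<Longrightarrow> False" for C
    using card_mono[OF fin', of C] v(2) by (simp add: degree_in_def)
  moreover have "B \<subseteq> neighborhood (A \<union> B) F v" if "v \<in> A"
  proof -
    have "{x, v} \<in> E" if "x \<in> B" for x
      using edges[OF \<open>v \<in> A\<close> that] by (simp add: insert_commute)
    then show ?thesis using that by (auto simp: neighborhood_def F_def)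
  qed
  moreover have "A \<subseteq> neighborhood (A \<union> B) F v" if "v \<in> B"
    using that edges by (auto simp: neighborhood_def F_def)
  ultimately show False using v(1) assms(5,6) by blast
qed

section \<open>Coefficients of the neighborhood polynomial\<close>

lemma finite_neighborhood_complex: "finite V \<Longrightarrow> finite (neighborhood_complex V E)"
  by (rule finite_subset[of _ "Pow V"]) (auto simp: neighborhood_complex_def)

lemma coeff_neighborhood_poly:
  assumes "finite V"
  shows "coeff (neighborhood_poly V E) j = card {A \<in> neighborhood_complex V E. card A = j}"
proof -
  have "coeff (neighborhood_poly V E) j = (\<Sum>A\<in>neighborhood_complex V E. of_bool (card A = j))"
    unfolding neighborhood_poly_def coeff_sum by (intro sum.cong) auto
  also have "\<dots> = card (neighborhood_complex V E \<inter> {A. card A = j})"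
    using finite_neighborhood_complex[OF assms] by simp
  finally show ?thesis by (simp add: Int_def)
qed

text \<open>The leading coefficient counts at least one member of the complex; its subsets are
  members of every smaller size, so there are no gaps.\<close>

lemma coeff_neighborhood_poly_0_iff:
  assumes "finite V" "V \<noteq> {}"
  shows "coeff (neighborhood_poly V E) j \<noteq> 0 \<longleftrightarrow> j \<le> degree (neighborhood_poly V E)"
proof
  assume "j \<le> degree (neighborhood_poly V E)"
  have "{} \<in> neighborhood_complex V E"
    using assms(2) by (auto simp: neighborhood_complex_def)
  then have "coeff (neighborhood_poly V E) 0 \<noteq> 0"
    using finite_neighborhood_complex[OF assms(1)]
    by (auto simp: coeff_neighborhood_poly[OF assms(1)] card_gt_0_iff)
  then have "neighborhood_poly V E \<noteq> 0" by auto
  then have "coeff (neighborhood_poly V E) (degree (neighborhood_poly V E)) \<noteq> 0" by simp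
  then have "{A \<in> neighborhood_complex V E. card A = degree (neighborhood_poly V E)} \<noteq> {}"
    unfolding coeff_neighborhood_poly[OF assms(1)] by (metis card.empty)
  then obtain A where A: "A \<in> neighborhood_complex V E" "card A = degree (neighborhood_poly V E)"
    by blast
  with \<open>j \<le> _\<close> obtain B where B: "B \<subseteq> A" "card B = j" "finite B"
    using obtain_subset_with_card_n[of j A] by metis
  then have "B \<in> {A \<in> neighborhood_complex V E. card A = j}"
    using A(1) unfolding neighborhood_complex_def by blast
  then show "coeff (neighborhood_poly V E) j \<noteq> 0"
    unfolding coeff_neighborhood_poly[OF assms(1)]
    using finite_neighborhood_complex[OF assms(1)] by (auto simp: card_gt_0_iff)
qed (rule le_degree)

lemma coeffs_eq_map:
  assumes "\<And>j. coeff p j \<noteq> 0 \<longleftrightarrow> j \<le> degree p" "degree p \<le> n"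
  shows "coeffs p = map (coeff p) [0..<card {j. j \<le> n \<and> coeff p j \<noteq> 0}]"
proof -
  have "{j. j \<le> n \<and> coeff p j \<noteq> 0} = {..degree p}" using assms by auto
  moreover have "p \<noteq> 0" using assms(1)[of 0] by auto
  ultimately show ?thesis by (simp add: coeffs_def)
qed

text \<open>The list \<open>vs\<close> is a bijection from indices to vertices; taking images under
  it carries index sets with a common neighbor to members of the complex.\<close>

lemma card_bounded_sets_eq:
  assumes "simple_graph V E" "distinct vs" "set vs = V"
  shows "card (bounded_sets (length vs) (\<lambda>i u. {vs ! i, vs ! u} \<in> E) j) =
    card {A \<in> neighborhood_complex V E. card A = j}" (is "card (bounded_sets ?n ?R j) = card ?X")
proof (rule bij_betw_same_card)
  have bij: "bij_betw ((!) vs) {..<?n} V"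
    using bij_betw_nth[OF assms(2) refl] assms(3) by simp
  then have inj: "inj_on ((!) vs) {..<?n}" and img: "(!) vs ` {..<?n} = V"
    by (auto simp: bij_betw_def)
  have common: "common ?n ?R A \<noteq> {} \<longleftrightarrow> (\<exists>v\<in>V. (!) vs ` A \<subseteq> neighborhood V E v)"
    if "A \<subseteq> {..<?n}" for A
  proof -
    have "(!) vs ` A \<subseteq> V" using that img by blast
    then have "(\<exists>v\<in>V. (!) vs ` A \<subseteq> neighborhood V E v) \<longleftrightarrow> (\<exists>v\<in>V. \<forall>i\<in>A. {vs ! i, v} \<in> E)"
      unfolding neighborhood_def by blast
    also have "\<dots> \<longleftrightarrow> (\<exists>u\<in>{..<?n}. \<forall>i\<in>A. {vs ! i, vs ! u} \<in> E)"
      unfolding img[symmetric] by simp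
    also have "\<dots> \<longleftrightarrow> common ?n ?R A \<noteq> {}" unfolding common_def by auto
    finally show ?thesis by blast
  qed
  have card: "card ((!) vs ` A) = card A" if "A \<subseteq> {..<?n}" for A
    by (rule card_image) (rule inj_on_subset[OF inj that])
  show "bij_betw ((`) ((!) vs)) (bounded_sets ?n ?R j) ?X"
  proof (rule bij_betw_subset[OF bij_betw_Pow[OF bij]])
    show "(`) ((!) vs) ` bounded_sets ?n ?R j = ?X"
    proof (intro subset_antisym subsetI)
      fix B assume "B \<in> (`) ((!) vs) ` bounded_sets ?n ?R j"
      then obtain A where A: "B = (!) vs ` A" "A \<subseteq> {..<?n}" "card A = j" "common ?n ?R A \<noteq> {}"
        unfolding bounded_sets_def by blast
      then show "B \<in> ?X"
        using common[OF A(2)] card[OF A(2)] img unfolding neighborhood_complex_def by blast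
    next
      fix B assume B: "B \<in> ?X"
      then have "B \<subseteq> (!) vs ` {..<?n}" unfolding img neighborhood_complex_def by blast
      then obtain A where A: "A \<subseteq> {..<?n}" "B = (!) vs ` A" by (rule subset_imageE)
      then have "A \<in> bounded_sets ?n ?R j"
        using B common[OF A(1)] card[OF A(1)]
        unfolding neighborhood_complex_def bounded_sets_def by simp
      with A(2) show "B \<in> (`) ((!) vs) ` bounded_sets ?n ?R j" by blast
    qed
  qed (auto simp: bounded_sets_def)
qed

section \<open>Layout and digit lengths of the input word\<close>

lemma nth_concat_map:
  assumes "\<And>x. x \<in> set xs \<Longrightarrow> length (f x) = n" "i < length xs" "u < n"
  shows "concat (map f xs) ! (i * n + u) = f (xs ! i) ! u"
  using assms
proof (induction xs arbitrary: i)
  case (Cons x xs)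
  show ?case
  proof (cases i)
    case (Suc i')
    have "concat (map f (x # xs)) ! (i * n + u) = concat (map f xs) ! (i' * n + u)"
      using Cons.prems(1)[of x] by (simp add: nth_append Suc)
    also have "\<dots> = f (xs ! i') ! u" using Cons.prems Suc by (intro Cons.IH) auto
    finally show ?thesis using Suc by simp
  qed (use Cons.prems in \<open>simp add: nth_append\<close>)
qed simp

lemma length_graph_code: "length (graph_code vs E) = 1 + length vs * length vs"
  by (simp add: graph_code_def length_concat o_def sum_list_triv)

lemma graph_code_nth:
  assumes "i < length vs" "u < length vs"
  shows "graph_code vs E ! (1 + i * length vs + u) = of_bool ({vs ! i, vs ! u} \<in> E)"
  using assms nth_concat_map[of vs "\<lambda>u. map (\<lambda>v. if {u, v} \<in> E then 1 else 0 :: nat) vs" "length vs" i u]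
  by (simp add: graph_code_def)

lemma graph_code_le: "x \<in> set (graph_code vs E) \<Longrightarrow> x \<le> 1 + length vs"
  by (auto simp: graph_code_def split: if_splits)

text \<open>A crude estimate suffices: \<open>x \<le> L\<close> gives \<open>x < 2 ^ L\<close>, so a
  bound on the values also bounds their lengths.\<close>

lemma fits_initial_state:
  assumes "length w \<le> L" "\<And>x. x \<in> set w \<Longrightarrow> x \<le> L"
  shows "fits L (initial_state w)"
proof -
  have "x < 2 ^ L" if "x \<le> L" for x using that less_exp[of L] by (rule le_less_trans)
  then show ?thesis using assms by (auto simp: fits_def initial_state_def bits_le_iff)
qed

lemma poly_nat_mono: "x \<le> y \<Longrightarrow> poly p x \<le> poly (p :: nat poly) y"
  by (induction p) (auto intro!: mult_mono)

theorem theorem11: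
  fixes k :: nat
  assumes "0 < k"
  shows "\<exists>(P :: com) (p :: nat poly). \<forall>(V :: nat set) E vs.
    simple_graph V E \<and> degenerate k V E \<and> distinct vs \<and> set vs = V \<longrightarrow>
    computes_within P (graph_code vs E) (coeffs (neighborhood_poly V E))
      (poly p (card V + card E))"
proof -
  obtain q :: "nat poly" where q: "cost N (nbr_poly_prog k) = poly q N" for N
    using cost_poly by blast
  \<comment> \<open>Composition with \<open>1 + x\<close> inserts the iteration bound
    \<open>n + 1\<close>. Then \<open>?p\<close> is the bound \<open>T * (1 + 2 * (L + T))\<close>
    of \<open>runs_in\<close>, with \<open>?q\<close> for \<open>T\<close> and the digit bound
    \<open>1 + n * n\<close> of the input for \<open>L\<close>.\<close>
  let ?q = "pcompose q [:1, 1:]"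
  let ?p = "?q * (1 + 2 * (1 + [:0, 1:] * [:0, 1:] + ?q))"
  show ?thesis
  proof (intro exI allI impI, elim conjE)
    fix V :: "nat set" and E vs
    assume G: "simple_graph V E" "degenerate k V E" and vs: "distinct vs" "set vs = V"
    define n where "n = length vs"
    define R where "R i u \<longleftrightarrow> {vs ! i, vs ! u} \<in> E" for i u
    have fin: "finite V" and n: "card V = n"
      using vs distinct_card[OF vs(1)] by (auto simp: n_def)
    have "k < n" using G(2) n by (simp add: degenerate_def)
    then have "V \<noteq> {}" using n by auto
    \<comment> \<open>Otherwise \<open>A\<close> and its common neighborhood would form a forbidden
      complete bipartite graph.\<close>
    have "card (common n R A) \<le> k" if "A \<subseteq> {..<n}" "k < card A" for A
    proof (rule ccontr)
      have sub: "common n R A \<subseteq> {..<n}" by (auto simp: common_def)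
      have img: "card ((!) vs ` B) = card B \<and> (!) vs ` B \<subseteq> V" if "B \<subseteq> {..<n}" for B
      proof
        show "card ((!) vs ` B) = card B"
          by (rule card_image) (use that vs(1) in \<open>auto simp: inj_on_def n_def nth_eq_iff_index_eq subset_eq\<close>)
        show "(!) vs ` B \<subseteq> V" using that vs(2) by (auto simp: n_def)
      qed
      assume "\<not> card (common n R A) \<le> k"
      then show False
        using img[OF that(1)] img[OF sub] that(2)
        by (intro degenerate_no_biclique[OF G, of "(!) vs ` A" "(!) vs ` common n R A"])
          (auto simp: common_def R_def)
    qed
    then have "out_coeff k n R j = card (bounded_sets n R j)" for j
      using \<open>k < n\<close> by (intro out_coeff_eq) (auto simp: R_def insert_commute)
    also have "card (bounded_sets n R j) = coeff (neighborhood_poly V E) j" for j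
      unfolding coeff_neighborhood_poly[OF fin] n_def R_def by (rule card_bounded_sets_eq[OF G(1) vs])
    finally have out: "out_coeff k n R = coeff (neighborhood_poly V E)" by (rule ext)
    have deg: "degree (neighborhood_poly V E) \<le> n"
      unfolding neighborhood_poly_def
    proof (rule degree_sum_le)
      fix A assume "A \<in> neighborhood_complex V E"
      then have "card A \<le> n" using card_mono[OF fin] n by (auto simp: neighborhood_complex_def)
      then show "degree (monom 1 (card A) :: nat poly) \<le> n" by (simp add: degree_monom_eq)
    qed (rule finite_neighborhood_complex[OF fin])
    have "wp (n + 1) (nbr_poly_prog k) (initial_state (graph_code vs E)) (\<lambda>s. output_of s =
      map (out_coeff k n R) [0..<card {j. j \<le> n \<and> out_coeff k n R j \<noteq> 0}])"
      using \<open>k < n\<close> length_graph_code[of vs E] graph_code_nth[of _ vs _ E]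
      by (intro wp_nbr_poly_prog) (simp_all add: R_def n_def, simp_all add: graph_code_def)
    then have "wp (n + 1) (nbr_poly_prog k) (initial_state (graph_code vs E))
      (\<lambda>s. output_of s = coeffs (neighborhood_poly V E))"
      unfolding out coeffs_eq_map[OF coeff_neighborhood_poly_0_iff[OF fin \<open>V \<noteq> {}\<close>] deg] .
    moreover have "fits (1 + n * n) (initial_state (graph_code vs E))"
    proof (rule fits_initial_state)
      show "x \<le> 1 + n * n" if "x \<in> set (graph_code vs E)" for x
        by (rule le_trans[OF graph_code_le[OF that]]) (unfold n_def, intro add_left_mono le_square)
    qed (simp add: length_graph_code n_def)
    ultimately obtain t s where ts: "exec (nbr_poly_prog k) (initial_state (graph_code vs E)) t s"
      "t \<le> cost (n + 1) (nbr_poly_prog k) * (1 + 2 * (1 + n * n + cost (n + 1) (nbr_poly_prog k)))"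
      "output_of s = coeffs (neighborhood_poly V E)"
      unfolding wp_def runs_in_def by blast
    note ts(2)
    also have "cost (n + 1) (nbr_poly_prog k) * (1 + 2 * (1 + n * n + cost (n + 1) (nbr_poly_prog k))) = poly ?p n"
      by (simp add: q poly_pcompose)
    \<comment> \<open>So far the bound is in terms of \<open>n = card V\<close>; monotonicity passes
      to the size of the graph.\<close>
    also have "\<dots> \<le> poly ?p (card V + card E)" by (rule poly_nat_mono) (simp add: n)
    finally show "computes_within (nbr_poly_prog k) (graph_code vs E)
        (coeffs (neighborhood_poly V E)) (poly ?p (card V + card E))"
      unfolding computes_within_def using ts(1,3) by blast
  qed
qed

end
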